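(* There is a natural embedding $\overline{\mathrm{SE}_3} \subset \mathbb{P}(1^4,2^7)$ compatible with the embedding $\alpha:\mathbb{P}(1^4,2^7)\to\mathbb P^{16}$ (that is, $\alpha$ restricts on it to the given inclusion $\overline{\mathrm{SE}_3}\subset\mathbb P^{16}$) such that the ideal of $\overline{\mathrm{SE}_3}$ in the coordinate ring of $\mathbb P(1^4,2^7)$ is minimally generated by the $4 \times 4$ Pfaffians of $$M =\begin{pmatrix} 0& -x_{1}+y_{1}& -x_{2}+y_{2}& -x_{3}+y_{3}& e_{0}\\ x_{1}-y_{1}& 0& x_{3}+y_{3}& -x_{2}-y_{2}& e_{1}\\ x_{2}-y_{2}& -x_{3}-y_{3}& 0& x_{1}+y_{1}& e_{2}\\ x_{3}-y_{3}& x_{2}+y_{2}& -x_{1}-y_{1}& 0& e_{3}\\ -e_{0}& -e_{1}& -e_{2}& -e_{3}& 0 \end{pmatrix}$$ and the quartic $y_1^2+y_2^2+y_3^2 - r\,(e_0^2+e_1^2+e_2^2+e_3^2)$. Furthermore, the identity element of $\mathrm{SE}_3$ has coordinates $(1:0:\dots:0)$ in this embedding.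
   Context: The base field is $\mathbb R$. $\mathrm{SE}_3$ is the group of direct isometries $v\mapsto Av+y$ of $\mathbb R^3$, with $A\in \mathrm{SO}_3$, $y\in\mathbb R^3$. $\mathbb P^{16}$ has coordinates $(A:x:y:r:h)$ with $A=(a_{i,j})$ a $3\times3$ matrix, $x=(x_1,x_2,x_3)$, $y=(y_1,y_2,y_3)$. Let $\phi:\mathrm{SE}_3\to\mathbb P^{16}$, $\phi(A,y)=(A:-A^ty:y:\langle y,y\rangle:1)$. $\overline{\mathrm{SE}_3}\subset\mathbb P^{16}$ is the zero locus of the ideal of all homogeneous polynomials vanishing on $\phi(\mathrm{SE}_3)$, with that ideal. $\mathbb P(1^4,2^7)$ is the weighted projective space with coordinates $e_0,\dots,e_3$ of degree 1 and $x_1,x_2,x_3,y_1,y_2,y_3,r$ of degree 2. The embedding $\alpha:\mathbb P(1^4,2^7)\to\mathbb P^{16}$ sends $(e:x:y:r)$ to the point with coordinates $A=E(e)$, $x$, $y$, $r$, $h=e_0^2+e_1^2+e_2^2+e_3^2$, where $$E(e)=\begin{pmatrix} e_0^2+e_1^2-e_2^2-e_3^2 & 2e_1e_2-2e_0e_3 & 2e_0e_2+2e_1e_3\\ 2e_1e_2+2e_0e_3 & e_0^2-e_1^2+e_2^2-e_3^2 & -2e_0e_1+2e_2e_3\\ -2e_0e_2+2e_1e_3 & 2e_0e_1+2e_2e_3 & e_0^2-e_1^2-e_2^2+e_3^2\end{pmatrix}$$ (it is the 2-uple embedding in suitable coordinates). The $4\times4$ Pfaffians of $M$ are the Pfaffians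 of the five skew-symmetric submatrices obtained by deleting the $i$-th row and $i$-th column. *)

theory Defs
  imports "HOL-Analysis.Analysis" "HOL-Library.Poly_Mapping"
begin

section \<open>Polynomials and ideals\<close>

type_synonym ('v, 'a) mpoly = "('v \<Rightarrow>\<^sub>0 nat) \<Rightarrow>\<^sub>0 'a"

definition Const :: "'a \<Rightarrow> ('v, 'a::zero) mpoly" where
  "Const c = Poly_Mapping.single 0 c"

definition Var :: "'v \<Rightarrow> ('v, 'a::zero_neq_one) mpoly" where
  "Var i = Poly_Mapping.single (Poly_Mapping.single i 1) 1"

text \<open>
  \<open>mpoly_hom c v\<close> applies \<open>c\<close> to the coefficients and substitutes \<open>v i\<close> for the variable \<open>i\<close>.
\<close>

definition mpoly_hom :: "('a \<Rightarrow> 'b) \<Rightarrow> ('v \<Rightarrow> 'b) \<Rightarrow> ('v, 'a::zero) mpoly \<Rightarrow> 'b::comm_semiring_1" where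
  "mpoly_hom c v p =
     (\<Sum>m\<in>Poly_Mapping.keys p.
        c (Poly_Mapping.lookup p m) * (\<Prod>i\<in>Poly_Mapping.keys m. v i ^ Poly_Mapping.lookup m i))"

abbreviation peval :: "('v \<Rightarrow> 'a) \<Rightarrow> ('v, 'a::comm_semiring_1) mpoly \<Rightarrow> 'a" where
  "peval v \<equiv> mpoly_hom (\<lambda>a. a) v"

abbreviation psubst :: "('v \<Rightarrow> ('w, 'a) mpoly) \<Rightarrow> ('v, 'a::comm_semiring_1) mpoly \<Rightarrow> ('w, 'a) mpoly" where
  "psubst v \<equiv> mpoly_hom Const v"

text \<open>\<open>d\<close> assigns to every variable its degree.\<close>

definition homogeneous :: "('v \<Rightarrow> nat) \<Rightarrow> nat \<Rightarrow> ('v, 'a::zero) mpoly \<Rightarrow> bool" where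
  "homogeneous d n p \<longleftrightarrow>
     (\<forall>m\<in>Poly_Mapping.keys p. (\<Sum>i\<in>Poly_Mapping.keys m. d i * Poly_Mapping.lookup m i) = n)"

lemma module_over_itself: "module ((*) :: 'a::comm_ring_1 \<Rightarrow> 'a \<Rightarrow> 'a)"
  by unfold_locales (simp_all add: algebra_simps)

text \<open>An ideal is a submodule of the ring, regarded as a module over itself.\<close>

definition ideal_generated :: "'a::comm_ring_1 set \<Rightarrow> 'a set" where
  "ideal_generated = module.span (*)"

definition minimally_generated_by :: "'a::comm_ring_1 set \<Rightarrow> 'a list \<Rightarrow> bool" where
  "minimally_generated_by I gs \<longleftrightarrow>
     I = ideal_generated (set gs) \<and>
     (\<forall>i<length gs. gs ! i \<notin> ideal_generated {gs ! j | j. j < length gs \<and> j \<noteq> i})"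

section \<open>Weighted projective spaces over the reals\<close>

text \<open>
  The real points of weighted projective space are represented by nonzero real vectors. Two
  vectors give the same point iff they differ by a scalar of the algebraic closure. If all
  weights are 1 this scalar is automatically real, but if all nonzero coordinates have weight 2
  then it may be imaginary: in \<open>P(1^4,2^7)\<close> the vectors \<open>(0,x,y,r)\<close> and \<open>(0,-x,-y,-r)\<close> give the
  same point.
\<close>

definition wpoint :: "('v \<Rightarrow> nat) \<Rightarrow> ('v \<Rightarrow> real) \<Rightarrow> ('v \<Rightarrow> real) set" where
  "wpoint d v = {w. \<exists>l::complex. l \<noteq> 0 \<and> (\<forall>i. complex_of_real (w i) = l ^ d i * complex_of_real (v i))}"

definition wproj :: "('v \<Rightarrow> nat) \<Rightarrow> ('v \<Rightarrow> real) set set" where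
  "wproj d = wpoint d ` {v. v \<noteq> (\<lambda>_. 0)}"

definition vanishing_ideal ::
    "('v \<Rightarrow> nat) \<Rightarrow> ('v \<Rightarrow> real) set set \<Rightarrow> ('v, real) mpoly set" where
  "vanishing_ideal d X =
     ideal_generated {f. (\<exists>n. homogeneous d n f) \<and> (\<forall>p\<in>X. \<forall>v\<in>p. peval v f = 0)}"

definition zero_locus ::
    "('v \<Rightarrow> nat) \<Rightarrow> ('v, real) mpoly set \<Rightarrow> ('v \<Rightarrow> real) set set" where
  "zero_locus d F = {p \<in> wproj d. \<forall>f\<in>F. \<forall>v\<in>p. peval v f = 0}"

definition zariski_closed :: "('v \<Rightarrow> nat) \<Rightarrow> ('v \<Rightarrow> real) set set \<Rightarrow> bool" where
  "zariski_closed d Z \<longleftrightarrow> (\<exists>F. (\<forall>f\<in>F. \<exists>n. homogeneous d n f) \<and> Z = zero_locus d F)"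

definition zariski_open_in ::
    "('v \<Rightarrow> nat) \<Rightarrow> ('v \<Rightarrow> real) set set \<Rightarrow> ('v \<Rightarrow> real) set set \<Rightarrow> bool" where
  "zariski_open_in d X U \<longleftrightarrow> (\<exists>Z. zariski_closed d Z \<and> U = X - Z)"

text \<open>
  A function is regular if it is locally a quotient of homogeneous polynomials of the same degree.
  As the distinguished open sets form a basis of the Zariski topology, one may take the set where
  the denominator does not vanish as the neighbourhood of \<open>p\<close>.
\<close>

definition regular_on ::
    "('v \<Rightarrow> nat) \<Rightarrow> ('v \<Rightarrow> real) set set \<Rightarrow> (('v \<Rightarrow> real) set \<Rightarrow> real) \<Rightarrow> bool" where
  "regular_on d U s \<longleftrightarrow>
     (\<forall>p\<in>U. \<exists>n f g. homogeneous d n f \<and> homogeneous d n g \<and> (\<forall>v\<in>p. peval v g \<noteq> 0) \<and>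
        (\<forall>q\<in>U. \<forall>v\<in>q. peval v g \<noteq> 0 \<longrightarrow> s q = peval v f / peval v g))"

definition regular_map ::
    "('v \<Rightarrow> nat) \<Rightarrow> ('v \<Rightarrow> real) set set \<Rightarrow> ('w \<Rightarrow> nat) \<Rightarrow> ('w \<Rightarrow> real) set set \<Rightarrow>
     (('v \<Rightarrow> real) set \<Rightarrow> ('w \<Rightarrow> real) set) \<Rightarrow> bool" where
  "regular_map d X d' Y h \<longleftrightarrow>
     h ` X \<subseteq> Y \<and>
     (\<forall>V. zariski_open_in d' Y V \<longrightarrow>
        zariski_open_in d X {p \<in> X. h p \<in> V} \<and>
        (\<forall>s. regular_on d' V s \<longrightarrow> regular_on d {p \<in> X. h p \<in> V} (s \<circ> h)))"

definition closed_embedding ::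
    "('v \<Rightarrow> nat) \<Rightarrow> ('v \<Rightarrow> real) set set \<Rightarrow> ('w \<Rightarrow> nat) \<Rightarrow>
     (('v \<Rightarrow> real) set \<Rightarrow> ('w \<Rightarrow> real) set) \<Rightarrow> bool" where
  "closed_embedding d X d' h \<longleftrightarrow>
     zariski_closed d' (h ` X) \<and> inj_on h X \<and>
     regular_map d X d' (h ` X) h \<and> regular_map d' (h ` X) d X (inv_into X h)"

section \<open>The compactification in 16-dimensional projective space\<close>

datatype pvar = PA 3 3 | PX 3 | PY 3 | PR | PH

abbreviation pdeg :: "pvar \<Rightarrow> nat" where
  "pdeg \<equiv> \<lambda>_. 1"

definition SE3 :: "(real^3 \<Rightarrow> real^3) set" where
  "SE3 = {g. \<exists>A y. rotation_matrix A \<and> g = (\<lambda>v. A *v v + y)}"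

definition phi_coords :: "real^3^3 \<Rightarrow> real^3 \<Rightarrow> pvar \<Rightarrow> real" where
  "phi_coords A y c =
     (case c of
        PA i j \<Rightarrow> A $ i $ j
      | PX i \<Rightarrow> (- (transpose A *v y)) $ i
      | PY i \<Rightarrow> y $ i
      | PR \<Rightarrow> y \<bullet> y
      | PH \<Rightarrow> 1)"

definition phi :: "(real^3 \<Rightarrow> real^3) \<Rightarrow> (pvar \<Rightarrow> real) set" where
  "phi g = wpoint pdeg (phi_coords (matrix (\<lambda>v. g v - g 0)) (g 0))"

lemma phi_affine: "phi (\<lambda>v. A *v v + y) = wpoint pdeg (phi_coords A y)"
  by (simp add: phi_def)

definition SE3_ideal :: "(pvar, real) mpoly set" where
  "SE3_ideal = vanishing_ideal pdeg (phi ` SE3)"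

definition SE3_closure :: "(pvar \<Rightarrow> real) set set" where
  "SE3_closure = zero_locus pdeg SE3_ideal"

section \<open>The weighted projective space and its embedding\<close>

text \<open>The index type \<open>4\<close> has the elements 0, 1, 2, 3.\<close>

datatype wvar = WE 4 | WX 3 | WY 3 | WR

fun wdeg :: "wvar \<Rightarrow> nat" where
  "wdeg (WE _) = 1"
| "wdeg _ = 2"

type_synonym wpoly = "(wvar, real) mpoly"

abbreviation ee :: "4 \<Rightarrow> wpoly" where "ee i \<equiv> Var (WE i)"
abbreviation xx :: "3 \<Rightarrow> wpoly" where "xx i \<equiv> Var (WX i)"
abbreviation yy :: "3 \<Rightarrow> wpoly" where "yy i \<equiv> Var (WY i)"
abbreviation rr :: wpoly where "rr \<equiv> Var WR"

definition Emat :: "wpoly^3^3" where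
  "Emat = vector
    [vector [(ee 0)^2 + (ee 1)^2 - (ee 2)^2 - (ee 3)^2, 2 * ee 1 * ee 2 - 2 * ee 0 * ee 3, 2 * ee 0 * ee 2 + 2 * ee 1 * ee 3],
     vector [2 * ee 1 * ee 2 + 2 * ee 0 * ee 3, (ee 0)^2 - (ee 1)^2 + (ee 2)^2 - (ee 3)^2, - 2 * ee 0 * ee 1 + 2 * ee 2 * ee 3],
     vector [- 2 * ee 0 * ee 2 + 2 * ee 1 * ee 3, 2 * ee 0 * ee 1 + 2 * ee 2 * ee 3, (ee 0)^2 - (ee 1)^2 - (ee 2)^2 + (ee 3)^2]]"

fun alpha_poly :: "pvar \<Rightarrow> wpoly" where
  "alpha_poly (PA i j) = Emat $ i $ j"
| "alpha_poly (PX i) = xx i"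
| "alpha_poly (PY i) = yy i"
| "alpha_poly PR = rr"
| "alpha_poly PH = (ee 0)^2 + (ee 1)^2 + (ee 2)^2 + (ee 3)^2"

text \<open>All representatives of \<open>p\<close> give the same class, so the union is that class.\<close>

definition alpha :: "(wvar \<Rightarrow> real) set \<Rightarrow> (pvar \<Rightarrow> real) set" where
  "alpha p = (\<Union>v\<in>p. wpoint pdeg (\<lambda>c. peval v (alpha_poly c)))"

section \<open>The generators\<close>

text \<open>Rows and columns of \<open>Mmat\<close> are counted from 0.\<close>

definition Mmat :: "nat \<Rightarrow> nat \<Rightarrow> wpoly" where
  "Mmat i j =
    [[0, - xx 1 + yy 1, - xx 2 + yy 2, - xx 3 + yy 3, ee 0],
     [xx 1 - yy 1, 0, xx 3 + yy 3, - xx 2 - yy 2, ee 1],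
     [xx 2 - yy 2, - xx 3 - yy 3, 0, xx 1 + yy 1, ee 2],
     [xx 3 - yy 3, xx 2 + yy 2, - xx 1 - yy 1, 0, ee 3],
     [- ee 0, - ee 1, - ee 2, - ee 3, 0]] ! i ! j"

definition pfaffian4 :: "(nat \<Rightarrow> nat \<Rightarrow> 'a::comm_ring_1) \<Rightarrow> 'a" where
  "pfaffian4 N = N 0 1 * N 2 3 - N 0 2 * N 1 3 + N 0 3 * N 1 2"

definition delete_row_col :: "nat \<Rightarrow> (nat \<Rightarrow> nat \<Rightarrow> 'a) \<Rightarrow> nat \<Rightarrow> nat \<Rightarrow> 'a" where
  "delete_row_col k N i j = N (if i < k then i else Suc i) (if j < k then j else Suc j)"

definition quartic :: wpoly where
  "quartic = (yy 1)^2 + (yy 2)^2 + (yy 3)^2 - rr * ((ee 0)^2 + (ee 1)^2 + (ee 2)^2 + (ee 3)^2)"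

definition generators :: "wpoly list" where
  "generators = map (\<lambda>k. pfaffian4 (delete_row_col k Mmat)) [0, 1, 2, 3, 4] @ [quartic]"

end

theory Submission
  imports Defs
begin

text \<open>
  With \<open>u = y - x\<close> and \<open>v = x + y\<close>, the Pfaffians are the Pluecker relations \<open>u \<cdot> v = 0\<close>,
  \<open>e \<cdot> v = 0\<close>, \<open>e\<^sub>0 v = e \<times> u\<close>, or equivalently \<open>e x + y e = 0\<close> in quaternions and
  \<open>|x| = |y|\<close>. Away from \<open>e = 0\<close> their solutions on the quartic are exactly the images of
  isometries, as \<open>E(e)\<close> is \<open>|e|\<^sup>2\<close> times the rotation given by \<open>e\<close>.

  A polynomial \<open>f\<close> vanishing at these solutions lies in the ideal of the generators for the following
  reason. Modulo that ideal, \<open>f\<close> is a combination of standard monomials, in which the leading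
  monomials \<open>e\<^sub>0 v\<^sub>i\<close>, \<open>e\<^sub>1 v\<^sub>1\<close>, \<open>u\<^sub>3 v\<^sub>3\<close> and \<open>r e\<^sub>3\<^sup>2\<close> do not occur. Along a suitable sequence of
  solutions, each coordinate is asymptotic to a multiple of a geometric sequence, and the resulting
  growth rates of distinct standard monomials are distinct by unique factorization. So these
  monomials are linearly independent as functions on the solutions.

  The linear forms which pull back to \<open>4 e\<^sub>i e\<^sub>j\<close> form a symmetric matrix of rank at most one on
  rotations, hence on the closure. So every point of the closure has a preimage under \<open>alpha\<close>. The
  inverse of \<open>alpha\<close> is regular because every weighted form of even degree is a polynomial in the
  coordinates of \<open>alpha\<close>, and forms \<open>f / g\<close> of odd degree can be replaced by \<open>f g / g\<^sup>2\<close>.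
\<close>

subsection \<open>Polynomials as linear combinations of monomials\<close>

definition monom_eval :: "('v \<Rightarrow> 'b) \<Rightarrow> ('v \<Rightarrow>\<^sub>0 nat) \<Rightarrow> 'b::comm_semiring_1" where
  "monom_eval v m = (\<Prod>i\<in>Poly_Mapping.keys m. v i ^ Poly_Mapping.lookup m i)"

lemma monom_eval_superset:
  assumes "finite S" "Poly_Mapping.keys m \<subseteq> S"
  shows "monom_eval v m = (\<Prod>i\<in>S. v i ^ Poly_Mapping.lookup m i)"
  unfolding monom_eval_def
  by (rule prod.mono_neutral_left) (use assms in \<open>auto simp: in_keys_iff\<close>)

lemma monom_eval_0 [simp]: "monom_eval v 0 = 1"
  by (simp add: monom_eval_def)

lemma monom_eval_single [simp]: "monom_eval v (Poly_Mapping.single i n) = v i ^ n"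
  by (simp add: monom_eval_def)

lemma monom_eval_add: "monom_eval v (m + n) = monom_eval v m * monom_eval v n"
proof -
  let ?S = "Poly_Mapping.keys m \<union> Poly_Mapping.keys n"
  have "monom_eval v (m + n) = (\<Prod>i\<in>?S. v i ^ Poly_Mapping.lookup (m + n) i)"
    by (rule monom_eval_superset) (auto simp: Poly_Mapping.keys_add)
  also have "\<dots> = monom_eval v m * monom_eval v n"
    by (simp add: lookup_add power_add prod.distrib monom_eval_superset[of ?S])
  finally show ?thesis .
qed

section \<open>Evaluation and substitution as ring homomorphisms\<close>

lemma mpoly_hom_alt:
  "mpoly_hom c v p = (\<Sum>m\<in>Poly_Mapping.keys p. c (Poly_Mapping.lookup p m) * monom_eval v m)"
  by (simp add: mpoly_hom_def monom_eval_def)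

lemma mpoly_expand: "(\<Sum>m\<in>Poly_Mapping.keys p. Poly_Mapping.single m (Poly_Mapping.lookup p m)) = p"
  by (rule poly_mapping_eqI)
    (simp add: lookup_sum lookup_single when_def in_keys_iff)

text \<open>A polynomial is the finite sum of its terms, so a property closed under addition need
  only be checked on single terms. The zero polynomial counts as a term with coefficient 0.\<close>

lemma mpoly_induct [case_names single add]:
  assumes "\<And>m a. P (Poly_Mapping.single m a)" "\<And>p q. P p \<Longrightarrow> P q \<Longrightarrow> P (p + q)"
  shows "P (p :: ('v, 'a::comm_monoid_add) mpoly)"
proof -
  have "P (\<Sum>m\<in>K. Poly_Mapping.single m (Poly_Mapping.lookup p m))" if "finite K" for K
    using that
  proof (induction K)
    case empty
    show ?case using assms(1)[of 0 0] by simp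
  qed (use assms in auto)
  from this[of "Poly_Mapping.keys p"] show ?thesis by (simp add: mpoly_expand)
qed

text \<open>One set of laws serves both evaluation, where \<open>c\<close> is the identity, and
  substitution, where \<open>c\<close> is \<open>Const\<close>.\<close>

locale coeff_hom =
  fixes c :: "'a::comm_semiring_1 \<Rightarrow> 'b::comm_semiring_1"
  assumes c_0: "c 0 = 0" and c_1: "c 1 = 1"
    and c_add: "c (a + b) = c a + c b" and c_mult: "c (a * b) = c a * c b"
begin

lemma mpoly_hom_superset:
  assumes "finite S" "Poly_Mapping.keys p \<subseteq> S"
  shows "mpoly_hom c v p = (\<Sum>m\<in>S. c (Poly_Mapping.lookup p m) * monom_eval v m)"
  unfolding mpoly_hom_alt
  by (rule sum.mono_neutral_left) (use assms in \<open>auto simp: in_keys_iff c_0\<close>)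

lemma mpoly_hom_single: "mpoly_hom c v (Poly_Mapping.single m a) = c a * monom_eval v m"
  by (simp add: mpoly_hom_superset[of "{m}"])

lemma mpoly_hom_0: "mpoly_hom c v 0 = 0"
  by (simp add: mpoly_hom_def)

lemma mpoly_hom_add: "mpoly_hom c v (p + q) = mpoly_hom c v p + mpoly_hom c v q"
proof -
  let ?S = "Poly_Mapping.keys p \<union> Poly_Mapping.keys q"
  have "mpoly_hom c v (p + q) = (\<Sum>m\<in>?S. c (Poly_Mapping.lookup (p + q) m) * monom_eval v m)"
    by (rule mpoly_hom_superset) (auto simp: Poly_Mapping.keys_add)
  also have "\<dots> = mpoly_hom c v p + mpoly_hom c v q"
    by (simp add: lookup_add c_add distrib_right sum.distrib mpoly_hom_superset[of ?S])
  finally show ?thesis .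
qed

lemma mpoly_hom_1: "mpoly_hom c v 1 = 1"
  using mpoly_hom_single[of v 0 1] by (simp add: c_1)

lemma mpoly_hom_mult: "mpoly_hom c v (p * q) = mpoly_hom c v p * mpoly_hom c v q"
proof (induction p rule: mpoly_induct)
  case (single m a)
  show ?case
  proof (induction q rule: mpoly_induct)
    case (single n b)
    show ?case
      by (simp add: mult_single mpoly_hom_single monom_eval_add c_mult mult.assoc mult.left_commute)
  qed (simp add: distrib_left mpoly_hom_add)
qed (simp add: distrib_right mpoly_hom_add)

lemma mpoly_hom_power: "mpoly_hom c v (p ^ n) = mpoly_hom c v p ^ n"
  by (induction n) (simp_all add: mpoly_hom_1 mpoly_hom_mult)

lemma mpoly_hom_Var: "mpoly_hom c v (Var i) = v i"
  by (simp add: Var_def mpoly_hom_single c_1)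

lemma mpoly_hom_Const: "mpoly_hom c v (Const a) = c a"
  by (simp add: Const_def mpoly_hom_single)

lemma mpoly_hom_of_nat: "mpoly_hom c v (of_nat n) = of_nat n"
  by (induction n) (simp_all add: mpoly_hom_0 mpoly_hom_1 mpoly_hom_add)

lemma mpoly_hom_numeral: "mpoly_hom c v (numeral n) = numeral n"
  using mpoly_hom_of_nat[of v "numeral n"] by simp

lemma mpoly_hom_sum: "mpoly_hom c v (sum f A) = (\<Sum>i\<in>A. mpoly_hom c v (f i))"
  by (induction A rule: infinite_finite_induct) (simp_all add: mpoly_hom_0 mpoly_hom_add)

end

locale coeff_ring_hom = coeff_hom c for c :: "'a::comm_ring_1 \<Rightarrow> 'b::comm_ring_1"
begin

lemma mpoly_hom_uminus: "mpoly_hom c v (- p) = - mpoly_hom c v p"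
  using mpoly_hom_add[of v "- p" p] by (simp add: mpoly_hom_0 eq_neg_iff_add_eq_0)

lemma mpoly_hom_diff: "mpoly_hom c v (p - q) = mpoly_hom c v p - mpoly_hom c v q"
  using mpoly_hom_add[of v p "- q"] by (simp add: mpoly_hom_uminus)

lemmas mpoly_hom_simps = mpoly_hom_0 mpoly_hom_1 mpoly_hom_add mpoly_hom_mult mpoly_hom_power
  mpoly_hom_Var mpoly_hom_Const mpoly_hom_numeral mpoly_hom_uminus mpoly_hom_diff

end

interpretation peval: coeff_ring_hom "\<lambda>a::'a::comm_ring_1. a"
  by unfold_locales simp_all

interpretation psubst: coeff_ring_hom "Const :: 'a::comm_ring_1 \<Rightarrow> ('v, 'a) mpoly"
  by unfold_locales (simp_all add: Const_def single_add mult_single)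

lemma psubst_peval: "peval v (psubst s p) = peval (\<lambda>i. peval v (s i)) p"
  for p :: "('v, 'a::comm_ring_1) mpoly"
proof (induction p rule: mpoly_induct)
  case (single m a)
  have "peval v (monom_eval s m) = monom_eval (\<lambda>i. peval v (s i)) m"
  proof -
    have "peval v (\<Prod>i\<in>S. s i ^ Poly_Mapping.lookup m i)
        = (\<Prod>i\<in>S. peval v (s i) ^ Poly_Mapping.lookup m i)" for S
      by (induction S rule: infinite_finite_induct) (simp_all add: peval.mpoly_hom_simps)
    then show ?thesis by (simp add: monom_eval_def)
  qed
  then show ?case
    by (simp add: psubst.mpoly_hom_single peval.mpoly_hom_single peval.mpoly_hom_simps)
qed (simp add: psubst.mpoly_hom_simps peval.mpoly_hom_simps)

lemma psubst_psubst: "psubst t (psubst s p) = psubst (\<lambda>i. psubst t (s i)) p"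
  for p :: "('v, 'a::comm_ring_1) mpoly"
proof (induction p rule: mpoly_induct)
  case (single m a)
  have "psubst t (monom_eval s m) = monom_eval (\<lambda>i. psubst t (s i)) m"
  proof -
    have "psubst t (\<Prod>i\<in>S. s i ^ Poly_Mapping.lookup m i)
        = (\<Prod>i\<in>S. psubst t (s i) ^ Poly_Mapping.lookup m i)" for S
      by (induction S rule: infinite_finite_induct) (simp_all add: psubst.mpoly_hom_simps)
    then show ?thesis by (simp add: monom_eval_def)
  qed
  then show ?case
    by (simp add: psubst.mpoly_hom_single psubst.mpoly_hom_simps)
qed (simp add: psubst.mpoly_hom_simps)

lemma Var_power: "Var i ^ k = Poly_Mapping.single (Poly_Mapping.single i k) (1 :: 'a::comm_ring_1)"
  by (induction k) (simp_all add: Var_def mult_single flip: single_add)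

lemma prod_Var_power:
  "(\<Prod>i\<in>S. Var i ^ f i)
     = Poly_Mapping.single (\<Sum>i\<in>S. Poly_Mapping.single i (f i)) (1 :: 'a::comm_ring_1)"
  by (induction S rule: infinite_finite_induct) (simp_all add: Var_power mult_single)

lemma single_eq_Const_monom: "Poly_Mapping.single m a = Const a * monom_eval Var m"
  for a :: "'a::comm_ring_1"
proof -
  have "(\<Sum>i\<in>Poly_Mapping.keys m. Poly_Mapping.single i (Poly_Mapping.lookup m i)) = m"
    by (rule poly_mapping_eqI)
      (simp add: lookup_sum lookup_single when_def in_keys_iff)
  then have "monom_eval Var m = Poly_Mapping.single m (1::'a)"
    by (simp add: monom_eval_def prod_Var_power)
  then show ?thesis
    by (simp add: Const_def mult_single)
qed

lemma psubst_Var [simp]: "psubst Var p = p"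
  for p :: "('v, 'a::comm_ring_1) mpoly"
  by (simp add: mpoly_hom_alt mpoly_expand flip: single_eq_Const_monom)

subsection \<open>Ideals\<close>

text \<open>\<open>ideal.subspace\<close> is the predicate of being an ideal, so facts about spans
  in modules become facts about generated ideals.\<close>

interpretation ideal: module "(*) :: 'a::comm_ring_1 \<Rightarrow> 'a \<Rightarrow> 'a"
  rewrites "module.span (*) = ideal_generated"
  by (fact module_over_itself) (simp add: ideal_generated_def)

text \<open>As a rewrite rule, this instance loops with \<open>mult.assoc\<close>.\<close>

declare ideal.scale_scale [simp del]

lemma ideal_generated_subsetI:
  assumes "f \<in> ideal_generated G" "ideal.subspace I" "G \<subseteq> I"
  shows "f \<in> I"
  using ideal.span_minimal[of G I] assms by auto

lemma ideal_vimage: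
  assumes "ideal.subspace I" "h 0 = 0" "\<And>a b. h (a + b) = h a + h b" "\<And>a b. h (a * b) = h a * h b"
  shows "ideal.subspace (h -` I)"
  using assms by (auto simp: ideal.subspace_def)

lemma ideal_peval_kernel: "ideal.subspace {f :: ('v, 'a::comm_ring_1) mpoly. peval v f = 0}"
  by (simp add: ideal.subspace_def peval.mpoly_hom_simps)

lemma peval_ideal_generated:
  fixes f :: "('v, 'a::comm_ring_1) mpoly"
  assumes "f \<in> ideal_generated G" "\<And>g. g \<in> G \<Longrightarrow> peval v g = 0"
  shows "peval v f = 0"
  using ideal_generated_subsetI[OF assms(1) ideal_peval_kernel[of v]] assms(2) by auto

lemma psubst_ideal_subspace:
  fixes s :: "'v \<Rightarrow> ('w, 'a::comm_ring_1) mpoly"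
  assumes "ideal.subspace I"
  shows "ideal.subspace (psubst s -` I)"
  by (rule ideal_vimage) (simp_all add: assms psubst.mpoly_hom_simps)

subsection \<open>Homogeneous polynomials\<close>

definition wtdeg :: "('v \<Rightarrow> nat) \<Rightarrow> ('v \<Rightarrow>\<^sub>0 nat) \<Rightarrow> nat" where
  "wtdeg d m = (\<Sum>i\<in>Poly_Mapping.keys m. d i * Poly_Mapping.lookup m i)"

lemma homogeneous_alt: "homogeneous d n p \<longleftrightarrow> (\<forall>m\<in>Poly_Mapping.keys p. wtdeg d m = n)"
  by (simp add: homogeneous_def wtdeg_def)

lemma wtdeg_superset:
  assumes "finite S" "Poly_Mapping.keys m \<subseteq> S"
  shows "wtdeg d m = (\<Sum>i\<in>S. d i * Poly_Mapping.lookup m i)"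
  unfolding wtdeg_def
  by (rule sum.mono_neutral_left) (use assms in \<open>auto simp: in_keys_iff\<close>)

lemma wtdeg_0 [simp]: "wtdeg d 0 = 0"
  by (simp add: wtdeg_def)

lemma wtdeg_single [simp]: "wtdeg d (Poly_Mapping.single i n) = d i * n"
  by (simp add: wtdeg_def)

lemma wtdeg_add: "wtdeg d (m + n) = wtdeg d m + wtdeg d n"
proof -
  let ?S = "Poly_Mapping.keys m \<union> Poly_Mapping.keys n"
  have "wtdeg d (m + n) = (\<Sum>i\<in>?S. d i * Poly_Mapping.lookup (m + n) i)"
    by (rule wtdeg_superset) (auto simp: Poly_Mapping.keys_add)
  also have "\<dots> = wtdeg d m + wtdeg d n"
    by (simp add: lookup_add distrib_left sum.distrib wtdeg_superset[of ?S])
  finally show ?thesis .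
qed

lemma homogeneous_0: "homogeneous d n 0"
  by (simp add: homogeneous_alt)

lemma homogeneous_single: "wtdeg d m = n \<Longrightarrow> homogeneous d n (Poly_Mapping.single m a)"
  by (simp add: homogeneous_alt)

lemma homogeneous_Const: "homogeneous d 0 (Const a)"
  by (simp add: Const_def homogeneous_single)

lemma homogeneous_1: "homogeneous d 0 1"
  by (simp add: homogeneous_alt)

lemma homogeneous_Var: "homogeneous d (d i) (Var i)"
  by (simp add: Var_def homogeneous_single)

lemma homogeneous_add:
  "homogeneous d n p \<Longrightarrow> homogeneous d n q \<Longrightarrow> homogeneous d n (p + q)"
  using Poly_Mapping.keys_add[of p q] by (auto simp: homogeneous_alt)

lemma homogeneous_uminus: "homogeneous d n p \<Longrightarrow> homogeneous d n (- p)"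
  for p :: "('v, 'a::comm_ring_1) mpoly"
  by (simp add: homogeneous_alt in_keys_iff)

lemma homogeneous_diff:
  "homogeneous d n p \<Longrightarrow> homogeneous d n q \<Longrightarrow> homogeneous d n (p - q)"
  for p :: "('v, 'a::comm_ring_1) mpoly"
  using homogeneous_add[of d n p "- q"] homogeneous_uminus[of d n q] by simp

lemma homogeneous_mult:
  assumes "homogeneous d m p" "homogeneous d n q" "k = m + n"
  shows "homogeneous d k (p * q)"
  using assms Poly_Mapping.keys_mult[of p q] by (fastforce simp: homogeneous_alt wtdeg_add)

lemma homogeneous_power:
  "homogeneous d m p \<Longrightarrow> k = n * m \<Longrightarrow> homogeneous d k (p ^ n)"
  by (induction n arbitrary: k) (auto intro: homogeneous_1 homogeneous_mult)

lemma homogeneous_sum: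
  "(\<And>i. i \<in> A \<Longrightarrow> homogeneous d n (f i)) \<Longrightarrow> homogeneous d n (sum f A)"
  by (induction A rule: infinite_finite_induct) (auto intro: homogeneous_0 homogeneous_add)

text \<open>Pulling back along \<open>alpha\<close> is the case \<open>k = 2\<close>: coordinates of
  degree 1 become forms of degree 2.\<close>

lemma homogeneous_psubst:
  fixes p :: "('v, 'a::comm_ring_1) mpoly"
  assumes "homogeneous d n p" "\<And>i. homogeneous d' (k * d i) (s i)"
  shows "homogeneous d' (k * n) (psubst s p)"
  unfolding mpoly_hom_alt
proof (rule homogeneous_sum)
  fix m assume m: "m \<in> Poly_Mapping.keys p"
  have "homogeneous d' (\<Sum>i\<in>S. k * (d i * Poly_Mapping.lookup m i))
          (\<Prod>i\<in>S. s i ^ Poly_Mapping.lookup m i)" for S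
    by (induction S rule: infinite_finite_induct)
      (auto intro!: homogeneous_1 homogeneous_mult homogeneous_power assms(2) simp: algebra_simps)
  from this[of "Poly_Mapping.keys m"] have "homogeneous d' (k * wtdeg d m) (monom_eval s m)"
    by (simp add: wtdeg_def monom_eval_def sum_distrib_left)
  with m assms(1) show "homogeneous d' (k * n) (Const (Poly_Mapping.lookup p m) * monom_eval s m)"
    by (intro homogeneous_mult[OF homogeneous_Const, where n = "k * n"]) (simp_all add: homogeneous_alt)
qed

section \<open>Homogeneous components and scaling\<close>

definition hom_component :: "('v \<Rightarrow> nat) \<Rightarrow> nat \<Rightarrow> ('v, 'a) mpoly \<Rightarrow> ('v, 'a::comm_monoid_add) mpoly" where
  "hom_component d n p = (\<Sum>m\<in>{m \<in> Poly_Mapping.keys p. wtdeg d m = n}.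
                    Poly_Mapping.single m (Poly_Mapping.lookup p m))"

lemma homogeneous_hom_component: "homogeneous d n (hom_component d n p)"
  unfolding hom_component_def by (rule homogeneous_sum) (simp add: homogeneous_single)

lemma sum_hom_component: "p = (\<Sum>n\<in>wtdeg d ` Poly_Mapping.keys p. hom_component d n p)"
  unfolding hom_component_def by (subst sum.image_gen[symmetric]) (simp_all add: mpoly_expand)

lemma monom_eval_wscale:
  fixes v :: "'v \<Rightarrow> 'b::comm_semiring_1"
  shows "monom_eval (\<lambda>i. l ^ d i * v i) m = l ^ wtdeg d m * monom_eval v m"
  by (simp add: monom_eval_def wtdeg_def power_mult_distrib prod.distrib power_sum power_mult)

lemma homogeneous_eval_wscale:
  fixes v :: "'v \<Rightarrow> 'b::comm_semiring_1"
  assumes "homogeneous d n f"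
  shows "mpoly_hom c (\<lambda>i. l ^ d i * v i) f = l ^ n * mpoly_hom c v f"
  using assms
  by (simp add: mpoly_hom_alt monom_eval_wscale sum_distrib_left homogeneous_alt mult.left_commute)

text \<open>The scalars in \<open>wpoint\<close> are complex, so a real polynomial has to be
  evaluated over the complex numbers before homogeneity can be applied.\<close>

lemma of_real_peval:
  "of_real (peval v f) = (mpoly_hom of_real (\<lambda>i. of_real (v i)) f :: 'b::{real_algebra_1,comm_ring_1})"
  by (simp add: mpoly_hom_def)

text \<open>Along the weighted ray through \<open>v\<close>, the value of \<open>f\<close> is a
  polynomial in \<open>t\<close> whose coefficients are the values of the homogeneous components at
  \<open>v\<close>. It has all positive reals as roots, hence is zero.\<close>

lemma hom_component_vanish:
  fixes f :: "('v, real) mpoly"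
  assumes "\<And>t. t > 0 \<Longrightarrow> peval (\<lambda>i. t ^ d i * v i) f = 0"
  shows "peval v (hom_component d n f) = 0"
proof (cases "n \<in> wtdeg d ` Poly_Mapping.keys f")
  case False
  then have "hom_component d n f = 0" by (auto simp: hom_component_def intro: sum.neutral)
  then show ?thesis by (simp add: peval.mpoly_hom_simps)
next
  case True
  define D where "D = wtdeg d ` Poly_Mapping.keys f"
  have "finite D" by (simp add: D_def)
  define p where "p = (\<Sum>k\<in>D. Polynomial.monom (peval v (hom_component d k f)) k)"
  have "poly p t = 0" if "t > 0" for t
  proof -
    have "peval (\<lambda>i. t ^ d i * v i) f = (\<Sum>k\<in>D. t ^ k * peval v (hom_component d k f))"
      by (subst sum_hom_component[of f d])
        (simp add: peval.mpoly_hom_sum D_def homogeneous_eval_wscale[OF homogeneous_hom_component])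
    with assms[OF that] show ?thesis
      by (simp add: p_def poly_sum poly_monom mult.commute)
  qed
  then have "{0<..} \<subseteq> {t. poly p t = 0}" by auto
  then have "p = 0"
    using infinite_Ioi[of "0::real"] poly_roots_finite[of p] finite_subset by blast
  then have "0 = coeff p n" by simp
  also have "\<dots> = (\<Sum>k\<in>D. if k = n then peval v (hom_component d k f) else 0)"
    by (simp add: p_def coeff_sum)
  also have "\<dots> = peval v (hom_component d n f)"
    using True by (subst sum.delta) (auto simp: D_def)
  finally show ?thesis by simp
qed

subsection \<open>Explicit generators\<close>

text \<open>The Pfaffian without the last row and column is the product (y - x).(y + x), which
  expands to |y|^2 - |x|^2. The other four are linear in \<open>e\<close>.\<close>

lemma generators_explicit:
  "generators =
    [(xx 3 + yy 3) * ee 3 + (xx 2 + yy 2) * ee 2 + (xx 1 + yy 1) * ee 1,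
     (yy 2 - xx 2) * ee 3 - (yy 3 - xx 3) * ee 2 + ee 0 * (xx 1 + yy 1),
     (yy 1 - xx 1) * ee 3 - (yy 3 - xx 3) * ee 1 - ee 0 * (xx 2 + yy 2),
     (yy 1 - xx 1) * ee 2 - (yy 2 - xx 2) * ee 1 + ee 0 * (xx 3 + yy 3),
     (yy 1)^2 + (yy 2)^2 + (yy 3)^2 - (xx 1)^2 - (xx 2)^2 - (xx 3)^2,
     quartic]"
  by (simp add: generators_def pfaffian4_def delete_row_col_def Mmat_def algebra_simps
      power2_eq_square)

definition gen_ideal :: "wpoly set" where
  "gen_ideal = ideal_generated (set generators)"

lemma gen_ideal_subspace: "ideal.subspace gen_ideal"
  by (simp add: gen_ideal_def)

lemma generators_nth_in_gen_ideal: "i < 6 \<Longrightarrow> generators ! i \<in> gen_ideal"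
  unfolding gen_ideal_def by (intro ideal.span_base nth_mem) (simp add: generators_def)

lemmas generator_in_gen_ideal =
  generators_nth_in_gen_ideal[of 0, unfolded generators_explicit, simplified]
  generators_nth_in_gen_ideal[of 1, unfolded generators_explicit, simplified]
  generators_nth_in_gen_ideal[of 2, unfolded generators_explicit, simplified]
  generators_nth_in_gen_ideal[of 3, unfolded generators_explicit, simplified]
  generators_nth_in_gen_ideal[of 4, unfolded generators_explicit, simplified]
  generators_nth_in_gen_ideal[of 5, unfolded generators_explicit, simplified]

subsection \<open>Straightening\<close>

text \<open>
  The entries of the matrix become variables: \<open>WX i\<close> now stands for \<open>y i - x i\<close> and \<open>WY i\<close> for
  \<open>x i + y i\<close>.
\<close>

fun entry :: "wvar \<Rightarrow> wpoly" where
  "entry (WE i) = ee i"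
| "entry (WX i) = yy i - xx i"
| "entry (WY i) = xx i + yy i"
| "entry WR = rr"

text \<open>A preimage under the linear change of coordinates, so that membership of a relation is
  checked by substituting \<open>entry\<close> into it.\<close>

definition entry_ideal :: "wpoly set" where
  "entry_ideal = psubst entry -` gen_ideal"

lemma entry_ideal_subspace: "ideal.subspace entry_ideal"
  unfolding entry_ideal_def by (rule psubst_ideal_subspace[OF gen_ideal_subspace])

text \<open>By the parallelogram law, a quarter of |y - x|^2 + |x + y|^2 is (|x|^2 + |y|^2) / 2, and
  adding half of |y|^2 - |x|^2 gives |y|^2. The number 1/4 enters as an element \<open>c\<close>
  because the identity is used in a polynomial ring, which has no division.\<close>

lemma quartic_straightened:
  fixes c :: "'a::comm_ring_1"
  assumes "4 * c = 1"
  shows "r * e3^2 - (c * ((y1 - x1)^2 + (y2 - x2)^2 + (y3 - x3)^2 + (x1 + y1)^2 + (x2 + y2)^2 + (x3 + y3)^2)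
      - r * (e0^2 + e1^2 + e2^2))
    = 2 * c * (y1^2 + y2^2 + y3^2 - x1^2 - x2^2 - x3^2)
      - (y1^2 + y2^2 + y3^2 - r * (e0^2 + e1^2 + e2^2 + e3^2))"
proof -
  have "c * ((y1 - x1)^2 + (y2 - x2)^2 + (y3 - x3)^2 + (x1 + y1)^2 + (x2 + y2)^2 + (x3 + y3)^2)
    + 2 * c * (y1^2 + y2^2 + y3^2 - x1^2 - x2^2 - x3^2) = (4 * c) * (y1^2 + y2^2 + y3^2)"
    by (simp add: algebra_simps power2_eq_square)
  then show ?thesis unfolding assms by (simp add: algebra_simps)
qed

text \<open>Each relation has the form of a leading monomial minus its replacement. In order, these
  are the three components of e0 v = e x u, then e.v = 0, u.v = 0, and the quartic.\<close>

lemma entry_ideal_relations: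
  "ee 0 * yy 1 - (ee 2 * xx 3 - ee 3 * xx 2) \<in> entry_ideal"
  "ee 0 * yy 2 - (ee 3 * xx 1 - ee 1 * xx 3) \<in> entry_ideal"
  "ee 0 * yy 3 - (ee 1 * xx 2 - ee 2 * xx 1) \<in> entry_ideal"
  "ee 1 * yy 1 - (- (ee 2 * yy 2) - ee 3 * yy 3) \<in> entry_ideal"
  "xx 3 * yy 3 - (- (xx 1 * yy 1) - xx 2 * yy 2) \<in> entry_ideal"
  "rr * (ee 3)^2 - (Const (1/4) * ((xx 1)^2 + (xx 2)^2 + (xx 3)^2 + (yy 1)^2 + (yy 2)^2 + (yy 3)^2)
     - rr * ((ee 0)^2 + (ee 1)^2 + (ee 2)^2)) \<in> entry_ideal"
proof -
  show "ee 0 * yy 1 - (ee 2 * xx 3 - ee 3 * xx 2) \<in> entry_ideal"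
    using generator_in_gen_ideal(2)
    by (simp add: entry_ideal_def psubst.mpoly_hom_simps algebra_simps)
  show "ee 0 * yy 2 - (ee 3 * xx 1 - ee 1 * xx 3) \<in> entry_ideal"
    using ideal.subspace_neg[OF gen_ideal_subspace generator_in_gen_ideal(3)]
    by (simp add: entry_ideal_def psubst.mpoly_hom_simps algebra_simps)
  show "ee 0 * yy 3 - (ee 1 * xx 2 - ee 2 * xx 1) \<in> entry_ideal"
    using generator_in_gen_ideal(4)
    by (simp add: entry_ideal_def psubst.mpoly_hom_simps algebra_simps)
  show "ee 1 * yy 1 - (- (ee 2 * yy 2) - ee 3 * yy 3) \<in> entry_ideal"
    using generator_in_gen_ideal(1)
    by (simp add: entry_ideal_def psubst.mpoly_hom_simps algebra_simps)
  show "xx 3 * yy 3 - (- (xx 1 * yy 1) - xx 2 * yy 2) \<in> entry_ideal"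
    using generator_in_gen_ideal(5)
    by (simp add: entry_ideal_def psubst.mpoly_hom_simps algebra_simps power2_eq_square)
  let ?c = "Const (1/4) :: wpoly"
  let ?p = "(yy 1)^2 + (yy 2)^2 + (yy 3)^2 - (xx 1)^2 - (xx 2)^2 - (xx 3)^2"
  let ?f = "rr * (ee 3)^2 - (?c * ((xx 1)^2 + (xx 2)^2 + (xx 3)^2 + (yy 1)^2 + (yy 2)^2 + (yy 3)^2)
     - rr * ((ee 0)^2 + (ee 1)^2 + (ee 2)^2))"
  have "4 * ?c = Const 4 * ?c"
    by (simp add: Const_def)
  also have "\<dots> = 1"
    by (simp add: psubst.c_1 flip: psubst.c_mult)
  finally have c: "4 * ?c = 1" .
  have "psubst entry ?f = 2 * ?c * ?p - quartic"
    unfolding quartic_def quartic_straightened[OF c, symmetric]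
    by (simp only: psubst.mpoly_hom_simps entry.simps)
  also have "\<dots> \<in> gen_ideal"
    by (intro ideal.subspace_diff ideal.subspace_scale gen_ideal_subspace generator_in_gen_ideal)
  finally show "?f \<in> entry_ideal"
    by (simp add: entry_ideal_def)
qed

text \<open>The monomials divisible by none of the six leading monomials of
  \<open>entry_ideal_relations\<close>.\<close>

definition standard :: "(wvar \<Rightarrow>\<^sub>0 nat) \<Rightarrow> bool" where
  "standard m \<longleftrightarrow>
     (Poly_Mapping.lookup m (WE 0) = 0 \<or> (\<forall>i. Poly_Mapping.lookup m (WY i) = 0)) \<and>
     (Poly_Mapping.lookup m (WE 1) = 0 \<or> Poly_Mapping.lookup m (WY 1) = 0) \<and>
     (Poly_Mapping.lookup m (WX 3) = 0 \<or> Poly_Mapping.lookup m (WY 3) = 0) \<and>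
     (Poly_Mapping.lookup m WR = 0 \<or> Poly_Mapping.lookup m (WE 3) < 2)"

text \<open>
  With these weights the leading term of each of the six relations is heavier than its other terms,
  so straightening terminates.
\<close>

fun weight :: "wvar \<Rightarrow> nat" where
  "weight (WE i) = (if i = 3 then 1 else 0)"
| "weight (WX i) = (if i = 3 then 3 else 0)"
| "weight (WY i) = (if i = 1 then 5 else if i = 2 then 4 else 3)"
| "weight WR = 9"

definition lighter :: "nat \<Rightarrow> wpoly \<Rightarrow> bool" where
  "lighter n p \<longleftrightarrow> (\<forall>m\<in>Poly_Mapping.keys p. wtdeg weight m < n)"

lemma lighter_homogeneous: "homogeneous weight k p \<Longrightarrow> k < n \<Longrightarrow> lighter n p"
  by (auto simp: lighter_def homogeneous_alt)

lemma lighter_add: "lighter n p \<Longrightarrow> lighter n q \<Longrightarrow> lighter n (p + q)"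
  using Poly_Mapping.keys_add[of p q] by (auto simp: lighter_def)

lemma lighter_uminus: "lighter n p \<Longrightarrow> lighter n (- p)"
  by (simp add: lighter_def in_keys_iff)

lemma lighter_diff: "lighter n p \<Longrightarrow> lighter n q \<Longrightarrow> lighter n (p - q)"
  using lighter_add[of n p "- q"] lighter_uminus[of n q] by simp

definition straightenable :: "wpoly set" where
  "straightenable = {g. \<exists>g'. (\<forall>m\<in>Poly_Mapping.keys g'. standard m) \<and> g - g' \<in> entry_ideal}"

lemma straightenable_0: "0 \<in> straightenable"
  unfolding straightenable_def
  by (auto intro!: exI[of _ 0] simp: ideal.subspace_0[OF entry_ideal_subspace])

lemma straightenable_add:
  assumes "p \<in> straightenable" "q \<in> straightenable"
  shows "p + q \<in> straightenable"
proof -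
  obtain p' q' where *: "\<forall>m\<in>Poly_Mapping.keys p'. standard m" "p - p' \<in> entry_ideal"
    "\<forall>m\<in>Poly_Mapping.keys q'. standard m" "q - q' \<in> entry_ideal"
    using assms by (auto simp: straightenable_def)
  then have "(p + q) - (p' + q') \<in> entry_ideal"
    using ideal.subspace_add[OF entry_ideal_subspace *(2,4)] by (simp add: algebra_simps)
  with * show ?thesis
    unfolding straightenable_def using Poly_Mapping.keys_add[of p' q'] by blast
qed

lemma straightenable_Const_mult:
  assumes "p \<in> straightenable"
  shows "Const a * p \<in> straightenable"
proof -
  obtain p' where *: "\<forall>m\<in>Poly_Mapping.keys p'. standard m" "p - p' \<in> entry_ideal"
    using assms by (auto simp: straightenable_def)
  have "Const a * p - Const a * p' \<in> entry_ideal"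
    using ideal.subspace_scale[OF entry_ideal_subspace *(2), of "Const a"]
    by (simp add: right_diff_distrib)
  moreover have "Poly_Mapping.keys (Const a * p') \<subseteq> Poly_Mapping.keys p'"
    using Poly_Mapping.keys_mult[of "Const a" p'] by (auto simp: Const_def split: if_splits)
  ultimately show ?thesis
    using * unfolding straightenable_def by blast
qed

lemma straightenable_sum:
  "(\<And>i. i \<in> A \<Longrightarrow> f i \<in> straightenable) \<Longrightarrow> sum f A \<in> straightenable"
  by (induction A rule: infinite_finite_induct) (auto intro: straightenable_0 straightenable_add)

lemma straightenable_cong:
  assumes "p - q \<in> entry_ideal" "q \<in> straightenable"
  shows "p \<in> straightenable"
proof -
  obtain q' where *: "\<forall>m\<in>Poly_Mapping.keys q'. standard m" "q - q' \<in> entry_ideal"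
    using assms by (auto simp: straightenable_def)
  then have "p - q' \<in> entry_ideal"
    using ideal.subspace_add[OF entry_ideal_subspace assms(1) *(2)] by simp
  with * show ?thesis unfolding straightenable_def by blast
qed

text \<open>Replacing the factor \<open>l\<close> of \<open>m = l + k\<close> by \<open>h\<close>
  yields monomials \<open>k + j\<close> with \<open>j\<close> lighter than \<open>l\<close>. They
  are lighter than \<open>m\<close>, so the induction hypothesis applies to them.\<close>

lemma straightening_step:
  assumes IH: "\<And>k. wtdeg weight k < wtdeg weight m \<Longrightarrow> monom_eval Var k \<in> straightenable"
    and rel: "p - h \<in> entry_ideal" "p = monom_eval Var l" "lighter (wtdeg weight l) h"
    and m: "m = l + k"
  shows "monom_eval Var m \<in> straightenable"
proof (rule straightenable_cong)
  show "monom_eval Var m - monom_eval Var k * h \<in> entry_ideal"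
    using ideal.subspace_scale[OF entry_ideal_subspace rel(1), of "monom_eval Var k"]
    by (simp add: m monom_eval_add rel(2) algebra_simps)
  have h: "h = (\<Sum>j\<in>Poly_Mapping.keys h. Const (Poly_Mapping.lookup h j) * monom_eval Var j)"
    by (metis psubst_Var mpoly_hom_alt)
  have "monom_eval Var k * h =
      (\<Sum>j\<in>Poly_Mapping.keys h. Const (Poly_Mapping.lookup h j) * monom_eval Var (k + j))"
    by (subst h) (simp add: sum_distrib_left monom_eval_add mult.left_commute)
  also have "\<dots> \<in> straightenable"
    using rel(3)
    by (intro straightenable_sum straightenable_Const_mult IH) (auto simp: m wtdeg_add lighter_def)
  finally show "monom_eval Var k * h \<in> straightenable" .
qed

lemma single_split:
  assumes "n \<le> Poly_Mapping.lookup m i"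
  obtains k where "m = Poly_Mapping.single i n + (k :: 'v \<Rightarrow>\<^sub>0 nat)"
proof
  show "m = Poly_Mapping.single i n + (m - Poly_Mapping.single i n)"
    using assms by (intro poly_mapping_eqI) (auto simp: lookup_add lookup_minus lookup_single when_def)
qed

lemma single_split2:
  assumes "n \<le> Poly_Mapping.lookup m i" "n' \<le> Poly_Mapping.lookup m j" "i \<noteq> j"
  obtains k where "m = (Poly_Mapping.single i n + Poly_Mapping.single j n') + (k :: 'v \<Rightarrow>\<^sub>0 nat)"
proof -
  obtain k where k: "m = Poly_Mapping.single i n + k"
    using assms(1) by (rule single_split)
  with assms have "n' \<le> Poly_Mapping.lookup k j"
    by (simp add: lookup_add lookup_single_not_eq)
  then obtain k' where "k = Poly_Mapping.single j n' + k'"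
    by (rule single_split)
  with k that show thesis by (simp add: add.assoc)
qed

text \<open>All six leading monomials have the shape \<open>Var i * Var j ^ n\<close> with distinct
  variables; the exponent 2 occurs only in r e3^2.\<close>

lemma straightening_step2:
  assumes IH: "\<And>k. wtdeg weight k < wtdeg weight m \<Longrightarrow> monom_eval Var k \<in> straightenable"
    and rel: "Var i * Var j ^ n - h \<in> entry_ideal" "lighter (weight i + n * weight j) h" "i \<noteq> j"
    and m: "Poly_Mapping.lookup m i \<noteq> 0" "n \<le> Poly_Mapping.lookup m j"
  shows "monom_eval Var m \<in> straightenable"
proof -
  obtain k where "m = (Poly_Mapping.single i 1 + Poly_Mapping.single j n) + k"
    using m rel(3) by (auto intro: single_split2[of 1 m i n j])
  from IH rel(1) _ _ this show ?thesis
    by (rule straightening_step) (use rel(2) in \<open>simp_all add: monom_eval_add wtdeg_add mult.commute\<close>)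
qed

text \<open>Induction on the weight: a monomial that is not standard is divisible by a leading
  monomial, and rewriting that factor makes it lighter.\<close>

lemma monom_straightenable: "monom_eval Var m \<in> straightenable"
proof (induction "wtdeg weight m" arbitrary: m rule: less_induct)
  case less
  note step = straightening_step2[of m, OF less]
  note lighter = lighter_diff lighter_uminus lighter_add lighter_homogeneous homogeneous_mult
    homogeneous_power homogeneous_Var homogeneous_Const
  consider (std) "standard m"
    | (s1) "Poly_Mapping.lookup m (WE 0) \<noteq> 0" "1 \<le> Poly_Mapping.lookup m (WY 1)"
    | (s2) "Poly_Mapping.lookup m (WE 0) \<noteq> 0" "1 \<le> Poly_Mapping.lookup m (WY 2)"
    | (s3) "Poly_Mapping.lookup m (WE 0) \<noteq> 0" "1 \<le> Poly_Mapping.lookup m (WY 3)"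
    | (e) "Poly_Mapping.lookup m (WE 1) \<noteq> 0" "1 \<le> Poly_Mapping.lookup m (WY 1)"
    | (u) "Poly_Mapping.lookup m (WX 3) \<noteq> 0" "1 \<le> Poly_Mapping.lookup m (WY 3)"
    | (r) "Poly_Mapping.lookup m WR \<noteq> 0" "2 \<le> Poly_Mapping.lookup m (WE 3)"
    unfolding standard_def forall_3 by force
  then show ?case
  proof cases
    case std
    have "monom_eval Var m = (Poly_Mapping.single m 1 :: wpoly)"
      using single_eq_Const_monom[of m "1::real"] by (simp add: Const_def)
    then have "Poly_Mapping.keys (monom_eval Var m :: wpoly) \<subseteq> {m}"
      by simp
    with std show ?thesis
      unfolding straightenable_def
      by (auto intro!: exI[of _ "monom_eval Var m"] simp: ideal.subspace_0[OF entry_ideal_subspace])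
  next
    case s1
    show ?thesis
    proof (rule step[OF _ _ _ _ s1])
      show "ee 0 * yy 1 ^ 1 - (ee 2 * xx 3 - ee 3 * xx 2) \<in> entry_ideal"
        using entry_ideal_relations(1) by simp
      show "lighter (weight (WE 0) + 1 * weight (WY 1)) (ee 2 * xx 3 - ee 3 * xx 2)"
        by (rule lighter refl | simp)+
    qed simp_all
  next
    case s2
    show ?thesis
    proof (rule step[OF _ _ _ _ s2])
      show "ee 0 * yy 2 ^ 1 - (ee 3 * xx 1 - ee 1 * xx 3) \<in> entry_ideal"
        using entry_ideal_relations(2) by simp
      show "lighter (weight (WE 0) + 1 * weight (WY 2)) (ee 3 * xx 1 - ee 1 * xx 3)"
        by (rule lighter refl | simp)+
    qed simp_all
  next
    case s3
    show ?thesis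
    proof (rule step[OF _ _ _ _ s3])
      show "ee 0 * yy 3 ^ 1 - (ee 1 * xx 2 - ee 2 * xx 1) \<in> entry_ideal"
        using entry_ideal_relations(3) by simp
      show "lighter (weight (WE 0) + 1 * weight (WY 3)) (ee 1 * xx 2 - ee 2 * xx 1)"
        by (rule lighter refl | simp)+
    qed simp_all
  next
    case e
    show ?thesis
    proof (rule step[OF _ _ _ _ e])
      show "ee 1 * yy 1 ^ 1 - (- (ee 2 * yy 2) - ee 3 * yy 3) \<in> entry_ideal"
        using entry_ideal_relations(4) by simp
      show "lighter (weight (WE 1) + 1 * weight (WY 1)) (- (ee 2 * yy 2) - ee 3 * yy 3)"
        by (rule lighter refl | simp)+
    qed simp_all
  next
    case u
    show ?thesis
    proof (rule step[OF _ _ _ _ u])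
      show "xx 3 * yy 3 ^ 1 - (- (xx 1 * yy 1) - xx 2 * yy 2) \<in> entry_ideal"
        using entry_ideal_relations(5) by simp
      show "lighter (weight (WX 3) + 1 * weight (WY 3)) (- (xx 1 * yy 1) - xx 2 * yy 2)"
        by (rule lighter refl | simp)+
    qed simp_all
  next
    case r
    let ?h = "Const (1/4) * ((xx 1)^2 + (xx 2)^2 + (xx 3)^2 + (yy 1)^2 + (yy 2)^2 + (yy 3)^2)
     - rr * ((ee 0)^2 + (ee 1)^2 + (ee 2)^2)"
    show ?thesis
    proof (rule step[OF _ _ _ _ r])
      show "rr * (ee 3)^2 - ?h \<in> entry_ideal"
        by (rule entry_ideal_relations)
      show "lighter (weight WR + 2 * weight (WE 3)) ?h"
        \<comment> \<open>The summands have different weights, so the products are expanded first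
          and each term is bounded separately.\<close>
        unfolding distrib_left by (rule lighter refl | simp)+
    qed simp_all
  qed
qed

lemma straightenable_UNIV: "p \<in> straightenable"
proof -
  have "p = (\<Sum>j\<in>Poly_Mapping.keys p. Const (Poly_Mapping.lookup p j) * monom_eval Var j)"
    by (metis psubst_Var mpoly_hom_alt)
  also have "\<dots> \<in> straightenable"
    by (intro straightenable_sum straightenable_Const_mult monom_straightenable)
  finally show ?thesis .
qed

subsection \<open>Independence of the standard monomials\<close>

lemma UNIV_wvar:
  "UNIV = {WE 0, WE 1, WE 2, WE 3, WX 1, WX 2, WX 3, WY 1, WY 2, WY 3, WR}"
proof -
  have "v \<in> {WE 0, WE 1, WE 2, WE 3, WX 1, WX 2, WX 3, WY 1, WY 2, WY 3, WR}" for v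
    by (cases v rule: wvar.exhaust) (use exhaust_3 exhaust_4 in fastforce)+
  then show ?thesis by blast
qed

lemma monom_eval_wvar:
  "monom_eval v m =
     v (WE 0) ^ Poly_Mapping.lookup m (WE 0) * v (WE 1) ^ Poly_Mapping.lookup m (WE 1) *
     v (WE 2) ^ Poly_Mapping.lookup m (WE 2) * v (WE 3) ^ Poly_Mapping.lookup m (WE 3) *
     v (WX 1) ^ Poly_Mapping.lookup m (WX 1) * v (WX 2) ^ Poly_Mapping.lookup m (WX 2) *
     v (WX 3) ^ Poly_Mapping.lookup m (WX 3) * v (WY 1) ^ Poly_Mapping.lookup m (WY 1) *
     v (WY 2) ^ Poly_Mapping.lookup m (WY 2) * v (WY 3) ^ Poly_Mapping.lookup m (WY 3) *
     v WR ^ Poly_Mapping.lookup m WR"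
proof -
  have "finite (UNIV :: wvar set)" by (simp add: UNIV_wvar)
  from monom_eval_superset[OF this subset_UNIV] show ?thesis
    by (simp add: UNIV_wvar mult.assoc)
qed

lemma wvar_mapping_eqI:
  assumes "Poly_Mapping.lookup m (WE 0) = Poly_Mapping.lookup m' (WE 0)"
    "Poly_Mapping.lookup m (WE 1) = Poly_Mapping.lookup m' (WE 1)"
    "Poly_Mapping.lookup m (WE 2) = Poly_Mapping.lookup m' (WE 2)"
    "Poly_Mapping.lookup m (WE 3) = Poly_Mapping.lookup m' (WE 3)"
    "Poly_Mapping.lookup m (WX 1) = Poly_Mapping.lookup m' (WX 1)"
    "Poly_Mapping.lookup m (WX 2) = Poly_Mapping.lookup m' (WX 2)"
    "Poly_Mapping.lookup m (WX 3) = Poly_Mapping.lookup m' (WX 3)"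
    "Poly_Mapping.lookup m (WY 1) = Poly_Mapping.lookup m' (WY 1)"
    "Poly_Mapping.lookup m (WY 2) = Poly_Mapping.lookup m' (WY 2)"
    "Poly_Mapping.lookup m (WY 3) = Poly_Mapping.lookup m' (WY 3)"
    "Poly_Mapping.lookup m WR = Poly_Mapping.lookup m' WR"
  shows "m = m'"
proof (rule poly_mapping_eqI)
  fix k show "Poly_Mapping.lookup m k = Poly_Mapping.lookup m' k"
    using UNIV_I[of k] assms unfolding UNIV_wvar by blast
qed

text \<open>
  A curve on the affine cone, in the coordinates given by \<open>entry\<close>, with \<open>u = s w\<close> and
  \<open>v = e \<times> w\<close> for \<open>s = 3^n\<close>, \<open>e = (2^n, 5^n, 7^n)\<close> and \<open>w = (11^n, 29^n, 41^n)\<close>. Each coordinate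
  is asymptotic to a constant times a power of \<open>rate\<close>. The primes satisfy \<open>29/11 > 5/2\<close> and
  \<open>41/29 > 7/5\<close>, so that the first term of each component of \<open>v\<close> dominates.
\<close>

fun entry_curve :: "nat \<Rightarrow> wvar \<Rightarrow> real" where
  "entry_curve n (WE i) = (if i = 0 then 3^n else if i = 1 then 2^n else if i = 2 then 5^n else 7^n)"
| "entry_curve n (WX i) = (if i = 1 then 33^n else if i = 2 then 87^n else 123^n)"
| "entry_curve n (WY i) =
     (if i = 1 then 205^n - 203^n else if i = 2 then 77^n - 82^n else 58^n - 55^n)"
| "entry_curve n WR =
     ((33^n)^2 + (87^n)^2 + (123^n)^2 + (205^n - 203^n)^2 + (77^n - 82^n)^2 + (58^n - 55^n)^2) /
     (4 * ((3^n)^2 + (2^n)^2 + (5^n)^2 + (7^n)^2))"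

text \<open>The base of the dominant power in each coordinate. In \<open>77^n - 82^n\<close> this is
  82, with coefficient -1. For \<open>WR\<close> it is the largest base in the numerator, squared,
  over the largest base in the denominator, squared.\<close>

fun rate :: "wvar \<Rightarrow> real" where
  "rate (WE i) = (if i = 0 then 3 else if i = 1 then 2 else if i = 2 then 5 else 7)"
| "rate (WX i) = (if i = 1 then 33 else if i = 2 then 87 else 123)"
| "rate (WY i) = (if i = 1 then 205 else if i = 2 then 82 else 58)"
| "rate WR = 205^2/7^2"

lemma rate_pos: "rate i > 0"
  by (cases i) auto

text \<open>After division by the dominant power only powers of ratios below 1 remain besides
  constants. The limits are 1, -1 or, for \<open>WR\<close>, 1/4.\<close>

lemma entry_curve_asymp: "\<exists>c. c \<noteq> 0 \<and> (\<lambda>n. entry_curve n i / rate i ^ n) \<longlonglongrightarrow> c"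
proof -
  have p: "(\<lambda>n. (a/b) ^ n) \<longlonglongrightarrow> 0" if "0 \<le> a" "a < b" for a b :: real
    by (rule LIMSEQ_power_zero) (use that in auto)
  have p2: "(\<lambda>n. ((a/b) ^ n)^2) \<longlonglongrightarrow> 0" if "0 \<le> a" "a < b" for a b :: real
    using tendsto_power[OF p[OF that], of 2] by simp
  have d: "(\<lambda>n. (a^n - b^n) / c^n) \<longlonglongrightarrow> A - B"
    if "(\<lambda>n. (a/c)^n) \<longlonglongrightarrow> A" "(\<lambda>n. (b/c)^n) \<longlonglongrightarrow> B" for a b c A B :: real
    using tendsto_diff[OF that] by (simp add: power_divide diff_divide_distrib)
  have one: "(\<lambda>n. (a/a) ^ n) \<longlonglongrightarrow> 1" if "a \<noteq> 0" for a :: real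
    using that by simp
  show ?thesis
  proof (cases i rule: wvar.exhaust)
    case (WE k)
    then show ?thesis by (intro exI[of _ 1]) (auto simp: forall_4)
  next
    case (WX k)
    then show ?thesis by (intro exI[of _ 1]) (auto simp: forall_4)
  next
    case (WY k)
    have 1: "(\<lambda>n. (205^n - 203^n) / 205^n :: real) \<longlonglongrightarrow> 1 - 0"
      by (rule d[OF one p]) simp_all
    have 2: "(\<lambda>n. (77^n - 82^n) / 82^n :: real) \<longlonglongrightarrow> 0 - 1"
      by (rule d[OF p one]) simp_all
    have 3: "(\<lambda>n. (58^n - 55^n) / 58^n :: real) \<longlonglongrightarrow> 1 - 0"
      by (rule d[OF one p]) simp_all
    show ?thesis
      using 1 2 3 by (cases "k = 2") (auto simp: WY intro: exI[of _ "1::real"] exI[of _ "-1::real"])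
  next
    case WR
    \<comment> \<open>The quotient with its numerator divided by \<open>(205^n)^2\<close> and its
      denominator by \<open>(7^n)^2\<close>.\<close>
    let ?f = "\<lambda>n. (((33/205)^n)^2 + ((87/205)^n)^2 + ((123/205)^n)^2
        + ((205^n - 203^n)/205^n)^2 + ((77^n - 82^n)/205^n)^2 + ((58^n - 55^n)/205^n)^2)
        / (4 * (((3/7)^n)^2 + ((2/7)^n)^2 + ((5/7)^n)^2 + ((7/7)^n)^2)) :: real"
    have "?f \<longlonglongrightarrow> (0 + 0 + 0 + (1 - 0)^2 + (0 - 0)^2 + (0 - 0)^2) / (4 * (0 + 0 + 0 + 1^2))"
      by (intro tendsto_divide tendsto_add tendsto_mult tendsto_const p2 tendsto_power d one p) simp_all
    moreover have "entry_curve n WR / rate WR ^ n = ?f n" for n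
    proof -
      have eq: "(X / (4 * Y)) / (205^2/7^2)^n = (X / (205^n)^2) / (4 * (Y / (7^n)^2))" for X Y :: real
      proof -
        have "(c ^ 2) ^ n = (c ^ n) ^ 2" for c :: real
          by (simp only: mult.commute flip: power_mult)
        then have "((205::real)^2/7^2)^n = (205^n)^2 / (7^n)^2"
          by (simp only: power_divide)
        moreover have "(X / (4 * Y)) / (a / b) = (X / a) / (4 * (Y / b))" for a b :: real
          by simp
        ultimately show ?thesis by metis
      qed
      show ?thesis
        unfolding entry_curve.simps rate.simps eq
        by (simp only: add_divide_distrib power_divide)
    qed
    ultimately have "(\<lambda>n. entry_curve n WR / rate WR ^ n) \<longlonglongrightarrow> 1/4"
      by simp
    then show ?thesis by (intro exI[of _ "1/4"]) (simp add: WR)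
  qed
qed

lemma monom_eval_power: "monom_eval (\<lambda>i. v i ^ n) m = monom_eval v m ^ n"
  by (simp add: monom_eval_def prod_power_distrib power_commutes flip: power_mult)
    (simp add: mult.commute)

lemma monom_eval_divide: "monom_eval (\<lambda>i. v i / w i) m = monom_eval v m / monom_eval w m"
  for v :: "'v \<Rightarrow> 'a::field"
  by (simp add: monom_eval_def power_divide prod_dividef)

lemma monom_curve_asymp:
  "\<exists>c. c \<noteq> 0 \<and> (\<lambda>n. monom_eval (entry_curve n) m / monom_eval rate m ^ n) \<longlonglongrightarrow> c"
proof -
  obtain c where c: "\<And>i. c i \<noteq> 0" "\<And>i. (\<lambda>n. entry_curve n i / rate i ^ n) \<longlonglongrightarrow> c i"
    using entry_curve_asymp by metis
  have "(\<lambda>n. monom_eval (\<lambda>i. entry_curve n i / rate i ^ n) m) \<longlonglongrightarrow> monom_eval c m"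
    unfolding monom_eval_def by (intro tendsto_prod tendsto_power c)
  moreover have "monom_eval c m \<noteq> 0"
    by (simp add: monom_eval_def c)
  ultimately show ?thesis
    by (auto simp: monom_eval_divide monom_eval_power)
qed

section \<open>Unique factorization of the growth rates\<close>

lemma prime_power_cancel:
  fixes p :: nat
  assumes "p ^ a * x = p ^ b * y" "coprime p x" "coprime p y" "p > 1"
  shows "a = b \<and> x = y"
proof -
  have "p ^ a dvd p ^ b * y" "p ^ b dvd p ^ a * x"
    using assms(1) by (metis dvd_triv_left)+
  then have "p ^ a dvd p ^ b" "p ^ b dvd p ^ a"
    using assms(2,3) by (simp_all only: coprime_dvd_mult_left_iff coprime_power_left_iff simp_thms)
  then have "a = b" using \<open>p > 1\<close> by (simp add: power_dvd_imp_le le_antisym)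
  with assms show ?thesis by simp
qed

text \<open>The primes are split off one at a time; each is coprime to the product of the later
  ones.\<close>

lemma prime_exponents_eq:
  fixes a b :: nat
  assumes "7^a7 * (3^a3 * (2^a2 * (5^a5 * (11^a11 * (29^a29 * 41^a41))))) =
    (7^b7 * (3^b3 * (2^b2 * (5^b5 * (11^b11 * (29^b29 * 41^b41))))) :: nat)"
  shows "a7 = b7 \<and> a3 = b3 \<and> a2 = b2 \<and> a5 = b5 \<and> a11 = b11 \<and> a29 = b29 \<and> a41 = b41"
proof -
  have cop: "coprime 7 (3::nat)" "coprime 7 (2::nat)" "coprime 7 (5::nat)" "coprime 7 (11::nat)"
    "coprime 7 (29::nat)" "coprime 7 (41::nat)" "coprime 3 (2::nat)" "coprime 3 (5::nat)"
    "coprime 3 (11::nat)" "coprime 3 (29::nat)" "coprime 3 (41::nat)" "coprime 2 (5::nat)"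
    "coprime 2 (11::nat)" "coprime 2 (29::nat)" "coprime 2 (41::nat)" "coprime 5 (11::nat)"
    "coprime 5 (29::nat)" "coprime 5 (41::nat)" "coprime 11 (29::nat)" "coprime 11 (41::nat)"
    "coprime 29 (41::nat)"
    by (simp_all add: coprime_iff_gcd_eq_1 gcd_non_0_nat)
  have 7: "a7 = b7" "3^a3 * (2^a2 * (5^a5 * (11^a11 * (29^a29 * 41^a41)))) =
    (3^b3 * (2^b2 * (5^b5 * (11^b11 * (29^b29 * 41^b41)))) :: nat)"
    using prime_power_cancel[OF assms] by (simp_all add: cop)
  have 3: "a3 = b3" "2^a2 * (5^a5 * (11^a11 * (29^a29 * 41^a41))) =
    (2^b2 * (5^b5 * (11^b11 * (29^b29 * 41^b41))) :: nat)"
    using prime_power_cancel[OF 7(2)] by (simp_all add: cop)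
  have 2: "a2 = b2" "5^a5 * (11^a11 * (29^a29 * 41^a41)) =
    (5^b5 * (11^b11 * (29^b29 * 41^b41)) :: nat)"
    using prime_power_cancel[OF 3(2)] by (simp_all add: cop)
  have 5: "a5 = b5" "11^a11 * (29^a29 * 41^a41) = (11^b11 * (29^b29 * 41^b41) :: nat)"
    using prime_power_cancel[OF 2(2)] by (simp_all add: cop)
  have 11: "a11 = b11" "29^a29 * 41^a41 = (29^b29 * 41^b41 :: nat)"
    using prime_power_cancel[OF 5(2)] by (simp_all add: cop)
  have 29: "a29 = b29" "41^a41 = (41^b41 :: nat)"
    using prime_power_cancel[OF 11(2)] by (simp_all add: cop)
  with 7 3 2 5 11 show ?thesis by simp
qed

text \<open>The part of the growth rate made of primes other than 7, from 33 = 3 * 11, 87 = 3 * 29,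
  123 = 3 * 41, 205 = 5 * 41, 82 = 2 * 41 and 58 = 2 * 29. The prime 7 is kept apart because
  \<open>rate WR\<close> has it in the denominator.\<close>

definition rate_cofactor :: "(wvar \<Rightarrow> nat) \<Rightarrow> nat" where
  "rate_cofactor l =
    3 ^ (l (WE 0) + l (WX 1) + l (WX 2) + l (WX 3)) *
    (2 ^ (l (WE 1) + l (WY 2) + l (WY 3)) * (5 ^ (l (WE 2) + l (WY 1) + 2 * l WR) *
    (11 ^ l (WX 1) * (29 ^ (l (WX 2) + l (WY 3)) *
     41 ^ (l (WX 3) + l (WY 2) + l (WY 1) + 2 * l WR)))))"

lemma rate_factorization:
  defines "l \<equiv> Poly_Mapping.lookup"
  shows "monom_eval rate m * 7 ^ (2 * l m WR) = of_nat (7 ^ l m (WE 3) * rate_cofactor (l m))"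
proof -
  have *: "(33::real)^k = 3^k * 11^k" "(87::real)^k = 3^k * 29^k" "(123::real)^k = 3^k * 41^k"
    "(205::real)^k = 5^k * 41^k" "(82::real)^k = 2^k * 41^k" "(58::real)^k = 2^k * 29^k" for k
    by (simp_all flip: power_mult_distrib)
  have 7: "(c^2/7^2)^k * 7^(2*k) = c^(2*k)" for c :: real and k
    by (simp add: power_divide power_mult)
  have "monom_eval rate m * 7 ^ (2 * l m WR) =
    3 ^ l m (WE 0) * 2 ^ l m (WE 1) * 5 ^ l m (WE 2) * 7 ^ l m (WE 3) *
    33 ^ l m (WX 1) * 87 ^ l m (WX 2) * 123 ^ l m (WX 3) *
    205 ^ l m (WY 1) * 82 ^ l m (WY 2) * 58 ^ l m (WY 3) * 205 ^ (2 * l m WR)"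
    unfolding 7[of 205, symmetric] by (simp add: monom_eval_wvar l_def)
  also have "\<dots> = of_nat (7 ^ l m (WE 3) * rate_cofactor (l m))"
    unfolding * rate_cofactor_def of_nat_mult of_nat_power of_nat_numeral power_add
    by (simp only: ac_simps)
  finally show ?thesis .
qed

text \<open>Seven prime exponents determine eleven exponents because the monomials are standard. For
  instance, \<open>r = 0 \<or> e3 < 2\<close> lets \<open>e3\<close> and \<open>r\<close> be
  recovered from the difference e3 - 2 r.\<close>

lemma exponents_determine_standard:
  fixes s e1 e2 e3 u1 u2 u3 v1 v2 v3 r :: nat
  assumes std: "s = 0 \<or> v1 = 0 \<and> v2 = 0 \<and> v3 = 0" "e1 = 0 \<or> v1 = 0" "u3 = 0 \<or> v3 = 0"
      "r = 0 \<or> e3 < 2"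
    and std': "s' = 0 \<or> v1' = 0 \<and> v2' = 0 \<and> v3' = 0" "e1' = 0 \<or> v1' = 0" "u3' = 0 \<or> v3' = 0"
      "r' = 0 \<or> e3' < 2"
    and eq: "e3 + 2 * r' = e3' + 2 * r" "s + u1 + u2 + u3 = s' + u1' + u2' + u3'"
      "e1 + v2 + v3 = e1' + v2' + v3'" "e2 + v1 + 2 * r = e2' + v1' + 2 * r'" "u1 = u1'"
      "u2 + v3 = u2' + v3'" "u3 + v2 + v1 + 2 * r = u3' + v2' + v1' + 2 * r'"
  shows "s = s' \<and> e1 = e1' \<and> e2 = e2' \<and> e3 = e3' \<and> u1 = u1' \<and> u2 = u2' \<and> u3 = u3' \<and>
    v1 = v1' \<and> v2 = v2' \<and> v3 = v3' \<and> r = r'"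
proof -
  have "r = r'"
    using std(4) std'(4) eq(1) by (elim disjE) linarith+
  then have r: "r = r'" "e3 = e3'"
    using eq(1) by simp_all
  have sums: "s + u2 + u3 = s' + u2' + u3'" "e1 + v2 + v3 = e1' + v2' + v3'" "e2 + v1 = e2' + v1'"
    "u2 + v3 = u2' + v3'" "u3 + v2 + v1 = u3' + v2' + v1'"
    using eq(2-4,6,7) unfolding r eq(5) by simp_all
  consider "s = 0" "s' = 0" | "v1 = 0" "v2 = 0" "v3 = 0" "v1' = 0" "v2' = 0" "v3' = 0"
    | "s = 0" "v1' = 0" "v2' = 0" "v3' = 0" | "s' = 0" "v1 = 0" "v2 = 0" "v3 = 0"
    using std(1) std'(1) by blast
  then have "v1 = v1' \<and> v2 = v2' \<and> v3 = v3'"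
  proof cases
    case 1
    \<comment> \<open>The sums now fix the differences e1 - v1 and u3 - v3. In each pair one number
      is 0, so the difference determines both.\<close>
    note sums' = sums[unfolded 1 add_0]
    have "v1 = v1'"
      using std(2) std'(2) sums' by (elim disjE) linarith+
    moreover have "v3 = v3'"
      using std(3) std'(3) sums' by (elim disjE) linarith+
    ultimately show ?thesis using sums' by linarith
  next
    case 3
    \<comment> \<open>Adding the last two sums and subtracting the first gives v1 + v2 + v3 = - s',
      so all of these vanish.\<close>
    then show ?thesis using sums by linarith
  next
    case 4
    then show ?thesis using sums by linarith
  qed simp
  then show ?thesis using r eq(5) sums by auto
qed

lemma inj_on_rate: "inj_on (monom_eval rate) {m. standard m}"
proof (rule inj_onI)
  fix m m' assume st: "m \<in> {m. standard m}" "m' \<in> {m. standard m}"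
    and eq: "monom_eval rate m = monom_eval rate m'"
  define l where "l = (Poly_Mapping.lookup :: (wvar \<Rightarrow>\<^sub>0 nat) \<Rightarrow> wvar \<Rightarrow> nat)"
  have fac: "real (7 ^ l m (WE 3) * rate_cofactor (l m)) = monom_eval rate m * 7 ^ (2 * l m WR)" for m
    by (simp only: rate_factorization l_def)
  \<comment> \<open>The exponent of 7 in a rate is e3 - 2 r, possibly negative. Each side is
    multiplied by the denominator of the other to obtain an equation of natural numbers.\<close>
  have "real (7 ^ (l m (WE 3) + 2 * l m' WR) * rate_cofactor (l m))
      = real (7 ^ l m (WE 3) * rate_cofactor (l m)) * 7 ^ (2 * l m' WR)"
    by (simp add: power_add)
  also have "\<dots> = real (7 ^ l m' (WE 3) * rate_cofactor (l m')) * 7 ^ (2 * l m WR)"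
    unfolding fac eq by simp
  also have "\<dots> = real (7 ^ (l m' (WE 3) + 2 * l m WR) * rate_cofactor (l m'))"
    by (simp add: power_add)
  finally have "7 ^ (l m (WE 3) + 2 * l m' WR) * rate_cofactor (l m)
      = 7 ^ (l m' (WE 3) + 2 * l m WR) * rate_cofactor (l m')"
    by (rule of_nat_eq_iff[THEN iffD1])
  note exps = prime_exponents_eq[OF this[unfolded rate_cofactor_def]]
  have "l m (WE 0) = l m' (WE 0) \<and> l m (WE 1) = l m' (WE 1) \<and> l m (WE 2) = l m' (WE 2) \<and>
    l m (WE 3) = l m' (WE 3) \<and> l m (WX 1) = l m' (WX 1) \<and> l m (WX 2) = l m' (WX 2) \<and>
    l m (WX 3) = l m' (WX 3) \<and> l m (WY 1) = l m' (WY 1) \<and> l m (WY 2) = l m' (WY 2) \<and>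
    l m (WY 3) = l m' (WY 3) \<and> l m WR = l m' WR"
    by (rule exponents_determine_standard)
      (use st exps in \<open>simp_all add: standard_def forall_3 l_def\<close>)
  then show "m = m'"
    by (intro wvar_mapping_eqI) (simp_all add: l_def)
qed

text \<open>After division by the powers of the largest rate \<open>R\<close>, all monomials of
  \<open>g\<close> tend to 0 except the single one with rate \<open>R\<close>, so its coefficient
  would have to be 0.\<close>

lemma standard_independent:
  assumes "\<forall>m\<in>Poly_Mapping.keys g. standard m" "\<And>n. peval (entry_curve n) g = 0"
  shows "g = 0"
proof (rule ccontr)
  assume "g \<noteq> 0"
  define K where "K = Poly_Mapping.keys g"
  have fin: "finite K" "K \<noteq> {}"
    using \<open>g \<noteq> 0\<close> by (auto simp: K_def in_keys_iff poly_mapping_eq_iff fun_eq_iff)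
  define R where "R = Max (monom_eval rate ` K)"
  have "R \<in> monom_eval rate ` K"
    unfolding R_def using fin by (intro Max_in) auto
  then obtain m where m: "m \<in> K" "R = monom_eval rate m" by auto
  have pos: "monom_eval rate k > 0" for k
    by (simp add: monom_eval_def prod_pos rate_pos)
  obtain c where c: "\<And>k. c k \<noteq> 0"
      "\<And>k. (\<lambda>n. monom_eval (entry_curve n) k / monom_eval rate k ^ n) \<longlonglongrightarrow> c k"
    using monom_curve_asymp by metis
  have lim: "(\<lambda>n. monom_eval (entry_curve n) k / R ^ n) \<longlonglongrightarrow> (if k = m then c m else 0)"
    if "k \<in> K" for k
  proof (cases "k = m")
    case True
    with c(2)[of m] m show ?thesis by simp
  next
    case False
    have "monom_eval rate k \<le> R"
      unfolding R_def using fin that by (intro Max_ge) auto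
    moreover have "monom_eval rate k \<noteq> R"
      using inj_on_rate False that m assms(1) by (auto simp: inj_on_def K_def)
    ultimately have "norm (monom_eval rate k / R) < 1"
      using pos[of k] pos[of m] m by simp
    from tendsto_mult[OF c(2)[of k] LIMSEQ_power_zero[OF this]]
    have "(\<lambda>n. monom_eval (entry_curve n) k / monom_eval rate k ^ n * (monom_eval rate k / R) ^ n)
        \<longlonglongrightarrow> 0" by simp
    moreover have "monom_eval (entry_curve n) k / monom_eval rate k ^ n * (monom_eval rate k / R) ^ n
        = monom_eval (entry_curve n) k / R ^ n" for n
      using pos[of k] by (simp add: power_divide)
    ultimately show ?thesis using False by simp
  qed
  have "(\<lambda>n. \<Sum>k\<in>K. Poly_Mapping.lookup g k * (monom_eval (entry_curve n) k / R ^ n))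
      \<longlonglongrightarrow> (\<Sum>k\<in>K. Poly_Mapping.lookup g k * (if k = m then c m else 0))"
    by (intro tendsto_sum tendsto_mult tendsto_const lim)
  moreover have "(\<Sum>k\<in>K. Poly_Mapping.lookup g k * (monom_eval (entry_curve n) k / R ^ n)) = 0" for n
  proof -
    have "(\<Sum>k\<in>K. Poly_Mapping.lookup g k * (monom_eval (entry_curve n) k / R ^ n)) =
        peval (entry_curve n) g / R ^ n"
      by (simp add: mpoly_hom_alt K_def sum_divide_distrib)
    with assms(2) show ?thesis by simp
  qed
  moreover have "(\<Sum>k\<in>K. Poly_Mapping.lookup g k * (if k = m then c m else 0))
      = Poly_Mapping.lookup g m * c m"
    using fin m by (simp add: if_distrib[of "\<lambda>x. _ * x"] sum.delta cong: if_cong)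
  ultimately have "Poly_Mapping.lookup g m * c m = 0"
    by (simp add: LIMSEQ_const_iff)
  with c(1) m show False by (auto simp: K_def in_keys_iff)
qed

section \<open>Return to the original coordinates\<close>

fun curve :: "nat \<Rightarrow> wvar \<Rightarrow> real" where
  "curve n (WX i) = (entry_curve n (WY i) - entry_curve n (WX i)) / 2"
| "curve n (WY i) = (entry_curve n (WY i) + entry_curve n (WX i)) / 2"
| "curve n v = entry_curve n v"

text \<open>The inverse of \<open>entry\<close>: from u = y - x and v = x + y one recovers x = (v -
  u) / 2 and y = (v + u) / 2.\<close>

fun entry_inv :: "wvar \<Rightarrow> wpoly" where
  "entry_inv (WX i) = Const (1/2) * (yy i - xx i)"
| "entry_inv (WY i) = Const (1/2) * (yy i + xx i)"
| "entry_inv v = Var v"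

lemma psubst_entry_inv: "psubst entry (psubst entry_inv f) = f"
proof -
  have "Const (1/2) * 2 = Const (1/2) * (Const 2 :: wpoly)"
    by (simp add: Const_def)
  also have "\<dots> = 1"
    by (simp add: psubst.c_1 flip: psubst.c_mult)
  finally have half: "Const (1/2) * (2 * p) = p" for p :: wpoly
    by (simp flip: mult.assoc)
  have "psubst entry (entry_inv i) = Var i" for i
    by (cases i) (simp_all add: psubst.mpoly_hom_simps half)
  then show ?thesis by (simp add: psubst_psubst)
qed

text \<open>In the new coordinates \<open>f\<close> is congruent to a combination \<open>g\<close>
  of standard monomials. As the ideal and \<open>f\<close> vanish on the curve, so does
  \<open>g\<close>, and independence gives \<open>g = 0\<close>.\<close>

lemma vanish_on_curve_imp_gen_ideal:
  assumes "\<And>n. peval (curve n) f = 0" "\<And>n g. g \<in> set generators \<Longrightarrow> peval (curve n) g = 0"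
  shows "f \<in> gen_ideal"
proof -
  obtain g where g: "\<forall>m\<in>Poly_Mapping.keys g. standard m" "psubst entry_inv f - g \<in> entry_ideal"
    using straightenable_UNIV[of "psubst entry_inv f"] by (auto simp: straightenable_def)
  then have *: "f - psubst entry g \<in> gen_ideal"
    by (simp add: entry_ideal_def psubst.mpoly_hom_simps psubst_entry_inv)
  have "peval (entry_curve n) g = 0" for n
  proof -
    have "peval (curve n) (f - psubst entry g) = 0"
      using * assms(2) unfolding gen_ideal_def by (rule peval_ideal_generated)
    then have "peval (curve n) (psubst entry g) = 0"
      by (simp add: peval.mpoly_hom_simps assms(1))
    moreover have "peval (curve n) (entry i) = entry_curve n i" for i
      by (cases i) (simp_all add: peval.mpoly_hom_simps field_simps)
    ultimately show ?thesis by (simp add: psubst_peval)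
  qed
  with g(1) have "g = 0" by (rule standard_independent)
  with * show ?thesis by (simp add: psubst.mpoly_hom_simps)
qed

subsection \<open>Points of weighted projective spaces\<close>

lemma wpoint_refl: "v \<in> wpoint d v"
  by (auto simp: wpoint_def intro!: exI[of _ 1])

lemma wpoint_sym: "w \<in> wpoint d v \<Longrightarrow> v \<in> wpoint d w"
  unfolding wpoint_def mem_Collect_eq
proof (elim exE conjE)
  fix l :: complex assume l: "l \<noteq> 0" "\<forall>i. complex_of_real (w i) = l ^ d i * complex_of_real (v i)"
  then show "\<exists>l. l \<noteq> 0 \<and> (\<forall>i. complex_of_real (v i) = l ^ d i * complex_of_real (w i))"
    by (intro exI[of _ "inverse l"]) (simp add: power_inverse)
qed

lemma wpoint_trans: "u \<in> wpoint d w \<Longrightarrow> w \<in> wpoint d v \<Longrightarrow> u \<in> wpoint d v"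
  unfolding wpoint_def mem_Collect_eq
proof (elim exE conjE)
  fix l k :: complex
  assume "l \<noteq> 0" "\<forall>i. complex_of_real (u i) = l ^ d i * complex_of_real (w i)"
    "k \<noteq> 0" "\<forall>i. complex_of_real (w i) = k ^ d i * complex_of_real (v i)"
  then show "\<exists>l. l \<noteq> 0 \<and> (\<forall>i. complex_of_real (u i) = l ^ d i * complex_of_real (v i))"
    by (intro exI[of _ "l * k"]) (simp add: power_mult_distrib)
qed

lemma wpoint_eq: "w \<in> wpoint d v \<Longrightarrow> wpoint d w = wpoint d v"
  by (auto intro: wpoint_trans wpoint_sym)

lemma wpoint_eq_iff: "wpoint d w = wpoint d v \<longleftrightarrow> w \<in> wpoint d v"
  using wpoint_eq wpoint_refl by metis

lemma wpoint_real_scale: "l \<noteq> 0 \<Longrightarrow> (\<lambda>i. l ^ d i * v i) \<in> wpoint d v"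
  by (auto simp: wpoint_def intro!: exI[of _ "complex_of_real l"])

lemma wpoint_nonzero:
  assumes "w \<in> wpoint d v" "v \<noteq> (\<lambda>_. 0)"
  shows "w \<noteq> (\<lambda>_. 0)"
proof -
  obtain i where i: "v i \<noteq> 0" using assms(2) by auto
  obtain l :: complex where "l \<noteq> 0" "complex_of_real (w i) = l ^ d i * complex_of_real (v i)"
    using assms(1) by (auto simp: wpoint_def)
  with i have "w i \<noteq> 0" by auto
  then show ?thesis by auto
qed

lemma wpoint_in_wproj: "v \<noteq> (\<lambda>_. 0) \<Longrightarrow> wpoint d v \<in> wproj d"
  by (auto simp: wproj_def)

text \<open>One scalar works for forms of all degrees at once, so that quotients of forms of equal
  degree can be compared.\<close>

lemma homogeneous_wpoint:
  assumes "w \<in> wpoint d v"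
  obtains l :: complex where "l \<noteq> 0"
    "\<And>n f. homogeneous d n f \<Longrightarrow> complex_of_real (peval w f) = l ^ n * complex_of_real (peval v f)"
proof -
  obtain l :: complex where l: "l \<noteq> 0" "\<And>i. complex_of_real (w i) = l ^ d i * complex_of_real (v i)"
    using assms by (auto simp: wpoint_def)
  have "complex_of_real (peval w f) = l ^ n * complex_of_real (peval v f)"
    if "homogeneous d n f" for n f
    unfolding of_real_peval l(2) by (rule homogeneous_eval_wscale[OF that])
  with l(1) show thesis by (rule that)
qed

lemma homogeneous_wpoint_zero_iff:
  "homogeneous d n f \<Longrightarrow> w \<in> wpoint d v \<Longrightarrow> peval w f = 0 \<longleftrightarrow> peval v f = 0"
  by (erule homogeneous_wpoint) (metis mult_eq_0_iff of_real_eq_0_iff power_not_zero)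

lemma homogeneous_wpoint_ratio:
  assumes "homogeneous d n f" "homogeneous d n g" "w \<in> wpoint d v"
  shows "peval w f / peval w g = peval v f / peval v g"
proof -
  obtain l :: complex where l: "l \<noteq> 0"
    "\<And>n f. homogeneous d n f \<Longrightarrow> complex_of_real (peval w f) = l ^ n * complex_of_real (peval v f)"
    using homogeneous_wpoint[OF assms(3)] by metis
  have "complex_of_real (peval w f / peval w g) = complex_of_real (peval v f / peval v g)"
    using l(1) by (simp add: l(2)[OF assms(1)] l(2)[OF assms(2)])
  then show ?thesis by (simp only: of_real_eq_iff)
qed

lemma vanish_wpoint_iff:
  "homogeneous d n f \<Longrightarrow> (\<forall>w\<in>wpoint d v. peval w f = 0) \<longleftrightarrow> peval v f = 0"
  using homogeneous_wpoint_zero_iff wpoint_refl by metis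

lemma wpoint_in_zero_locus_iff:
  assumes "\<forall>f\<in>F. \<exists>n. homogeneous d n f" "v \<noteq> (\<lambda>_. 0)"
  shows "wpoint d v \<in> zero_locus d F \<longleftrightarrow> (\<forall>f\<in>F. peval v f = 0)"
proof -
  have "(\<forall>w\<in>wpoint d v. peval w f = 0) \<longleftrightarrow> peval v f = 0" if "f \<in> F" for f
    using assms(1) that vanish_wpoint_iff by metis
  with assms(2) show ?thesis
    by (auto simp: zero_locus_def wpoint_in_wproj)
qed

lemma vanishing_ideal_subspace: "ideal.subspace (vanishing_ideal d X)"
  by (simp add: vanishing_ideal_def)

lemma vanishing_idealD:
  assumes "f \<in> vanishing_ideal d X" "p \<in> X" "v \<in> p"
  shows "peval v f = 0"
  using assms(1) unfolding vanishing_ideal_def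
  by (rule peval_ideal_generated) (use assms in auto)

lemma vanishing_idealI:
  assumes "homogeneous d n f" "\<And>p v. p \<in> X \<Longrightarrow> v \<in> p \<Longrightarrow> peval v f = 0"
  shows "f \<in> vanishing_ideal d X"
  unfolding vanishing_ideal_def by (rule ideal.span_base) (use assms in auto)

subsection \<open>The embedding \<open>alpha\<close>\<close>

text \<open>In the index type the numeral 4 equals 0, so the quaternion indices 0, 1, 2, 3 exhaust
  it.\<close>

lemma forall_4_from_0: "(\<forall>i::4. P i) \<longleftrightarrow> P 0 \<and> P 1 \<and> P 2 \<and> P 3"
proof -
  have "(4::4) = 0" by simp
  then show ?thesis by (metis forall_4)
qed

lemma Emat_simps:
  "Emat $ 1 $ 1 = (ee 0)^2 + (ee 1)^2 - (ee 2)^2 - (ee 3)^2"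
  "Emat $ 1 $ 2 = 2 * ee 1 * ee 2 - 2 * ee 0 * ee 3"
  "Emat $ 1 $ 3 = 2 * ee 0 * ee 2 + 2 * ee 1 * ee 3"
  "Emat $ 2 $ 1 = 2 * ee 1 * ee 2 + 2 * ee 0 * ee 3"
  "Emat $ 2 $ 2 = (ee 0)^2 - (ee 1)^2 + (ee 2)^2 - (ee 3)^2"
  "Emat $ 2 $ 3 = - 2 * ee 0 * ee 1 + 2 * ee 2 * ee 3"
  "Emat $ 3 $ 1 = - 2 * ee 0 * ee 2 + 2 * ee 1 * ee 3"
  "Emat $ 3 $ 2 = 2 * ee 0 * ee 1 + 2 * ee 2 * ee 3"
  "Emat $ 3 $ 3 = (ee 0)^2 - (ee 1)^2 - (ee 2)^2 + (ee 3)^2"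
  by (simp_all add: Emat_def)

definition alpha_vec :: "(wvar \<Rightarrow> real) \<Rightarrow> pvar \<Rightarrow> real" where
  "alpha_vec v c = peval v (alpha_poly c)"

lemma alpha_vec_simps:
  "alpha_vec v (PA 1 1) = (v (WE 0))^2 + (v (WE 1))^2 - (v (WE 2))^2 - (v (WE 3))^2"
  "alpha_vec v (PA 1 2) = 2 * v (WE 1) * v (WE 2) - 2 * v (WE 0) * v (WE 3)"
  "alpha_vec v (PA 1 3) = 2 * v (WE 0) * v (WE 2) + 2 * v (WE 1) * v (WE 3)"
  "alpha_vec v (PA 2 1) = 2 * v (WE 1) * v (WE 2) + 2 * v (WE 0) * v (WE 3)"
  "alpha_vec v (PA 2 2) = (v (WE 0))^2 - (v (WE 1))^2 + (v (WE 2))^2 - (v (WE 3))^2"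
  "alpha_vec v (PA 2 3) = - 2 * v (WE 0) * v (WE 1) + 2 * v (WE 2) * v (WE 3)"
  "alpha_vec v (PA 3 1) = - 2 * v (WE 0) * v (WE 2) + 2 * v (WE 1) * v (WE 3)"
  "alpha_vec v (PA 3 2) = 2 * v (WE 0) * v (WE 1) + 2 * v (WE 2) * v (WE 3)"
  "alpha_vec v (PA 3 3) = (v (WE 0))^2 - (v (WE 1))^2 - (v (WE 2))^2 + (v (WE 3))^2"
  "alpha_vec v (PX i) = v (WX i)"
  "alpha_vec v (PY i) = v (WY i)"
  "alpha_vec v PR = v WR"
  "alpha_vec v PH = (v (WE 0))^2 + (v (WE 1))^2 + (v (WE 2))^2 + (v (WE 3))^2"
  by (simp_all add: alpha_vec_def Emat_simps peval.mpoly_hom_simps)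

lemma peval_psubst_alpha: "peval v (psubst alpha_poly f) = peval (alpha_vec v) f"
  by (simp add: psubst_peval alpha_vec_def[abs_def])

lemma homogeneous_wvars:
  "homogeneous wdeg 1 (ee i)" "homogeneous wdeg 2 (xx j)" "homogeneous wdeg 2 (yy j)"
  "homogeneous wdeg 2 rr"
  using homogeneous_Var[of wdeg "WE i"] homogeneous_Var[of wdeg "WX j"]
    homogeneous_Var[of wdeg "WY j"] homogeneous_Var[of wdeg WR] by simp_all

lemma homogeneous_numeral: "homogeneous d 0 (numeral k :: ('v, 'a::comm_ring_1) mpoly)"
  unfolding single_numeral[symmetric] by (rule homogeneous_single) simp

lemmas homogeneous_intros = homogeneous_add homogeneous_diff homogeneous_uminus homogeneous_mult
  homogeneous_power homogeneous_numeral homogeneous_wvars homogeneous_Var homogeneous_Const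

lemma homogeneous_alpha_poly: "homogeneous wdeg 2 (alpha_poly c)"
proof -
  have "homogeneous wdeg 2 (Emat $ i $ j)" for i j
  proof -
    have "\<forall>i j. homogeneous wdeg 2 (Emat $ i $ j)"
      unfolding forall_3 Emat_simps by (intro conjI) (rule homogeneous_intros | simp)+
    then show ?thesis by blast
  qed
  moreover have "homogeneous wdeg 2 ((ee 0)^2 + (ee 1)^2 + (ee 2)^2 + (ee 3)^2)"
    by (rule homogeneous_intros | simp)+
  ultimately show ?thesis
    by (cases c) (simp_all add: homogeneous_wvars)
qed

lemma homogeneous_psubst_alpha:
  "homogeneous pdeg n f \<Longrightarrow> homogeneous wdeg (2 * n) (psubst alpha_poly f)"
  by (erule homogeneous_psubst) (simp only: mult_1_right homogeneous_alpha_poly)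

text \<open>All coordinates of \<open>alpha\<close> have degree 2, so a weighted scalar
  \<open>l\<close> acts on the image as \<open>l^2\<close>.\<close>

lemma alpha_vec_wpoint:
  assumes "w \<in> wpoint wdeg v"
  shows "alpha_vec w \<in> wpoint pdeg (alpha_vec v)"
proof -
  obtain l :: complex where l: "l \<noteq> 0"
    "\<And>n f. homogeneous wdeg n f \<Longrightarrow> complex_of_real (peval w f) = l ^ n * complex_of_real (peval v f)"
    using homogeneous_wpoint[OF assms] by metis
  show ?thesis
    unfolding wpoint_def alpha_vec_def
    using l by (auto intro!: exI[of _ "l^2"] simp: l(2)[OF homogeneous_alpha_poly])
qed

lemma alpha_wpoint: "alpha (wpoint wdeg v) = wpoint pdeg (alpha_vec v)"
proof -
  have "wpoint pdeg (alpha_vec w) = wpoint pdeg (alpha_vec v)" if "w \<in> wpoint wdeg v" for w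
    using alpha_vec_wpoint[OF that] by (rule wpoint_eq)
  then show ?thesis
    unfolding alpha_def alpha_vec_def[symmetric] using wpoint_refl[of v wdeg] by blast
qed

text \<open>
  The symmetric matrix of linear forms that \<open>alpha\<close> pulls back to \<open>4 e\<^sub>i e\<^sub>j\<close>.
\<close>

definition quat_form :: "(pvar \<Rightarrow> 'a::comm_ring_1) \<Rightarrow> 4 \<Rightarrow> 4 \<Rightarrow> 'a" where
  "quat_form w i j =
    (if i = 0 then
       if j = 0 then w PH + w (PA 1 1) + w (PA 2 2) + w (PA 3 3)
       else if j = 1 then w (PA 3 2) - w (PA 2 3)
       else if j = 2 then w (PA 1 3) - w (PA 3 1)
       else w (PA 2 1) - w (PA 1 2)
     else if i = 1 then
       if j = 0 then w (PA 3 2) - w (PA 2 3)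
       else if j = 1 then w PH + w (PA 1 1) - w (PA 2 2) - w (PA 3 3)
       else if j = 2 then w (PA 1 2) + w (PA 2 1)
       else w (PA 1 3) + w (PA 3 1)
     else if i = 2 then
       if j = 0 then w (PA 1 3) - w (PA 3 1)
       else if j = 1 then w (PA 1 2) + w (PA 2 1)
       else if j = 2 then w PH - w (PA 1 1) + w (PA 2 2) - w (PA 3 3)
       else w (PA 2 3) + w (PA 3 2)
     else
       if j = 0 then w (PA 2 1) - w (PA 1 2)
       else if j = 1 then w (PA 1 3) + w (PA 3 1)
       else if j = 2 then w (PA 2 3) + w (PA 3 2)
       else w PH - w (PA 1 1) - w (PA 2 2) + w (PA 3 3))"

lemma quat_form_psubst_alpha: "psubst alpha_poly (quat_form Var i j) = 4 * ee i * ee j"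
proof -
  have "\<forall>i j. psubst alpha_poly (quat_form Var i j) = 4 * ee i * ee j"
    unfolding forall_4_from_0
    by (simp add: quat_form_def psubst.mpoly_hom_simps Emat_simps power2_eq_square)
  then show ?thesis by blast
qed

lemma peval_quat_form: "peval w (quat_form Var i j) = quat_form w i j"
  for w :: "pvar \<Rightarrow> real"
  by (simp add: quat_form_def peval.mpoly_hom_simps)

lemma quat_form_alpha_vec: "quat_form (alpha_vec v) i j = 4 * v (WE i) * v (WE j)"
proof -
  have "quat_form (alpha_vec v) i j = peval v (psubst alpha_poly (quat_form Var i j))"
    by (simp only: peval_psubst_alpha peval_quat_form)
  then show ?thesis
    by (simp add: quat_form_psubst_alpha peval.mpoly_hom_simps)
qed

lemma homogeneous_quat_form: "homogeneous pdeg 1 (quat_form Var i j)"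
proof -
  have "homogeneous pdeg 1 (Var c)" for c
    using homogeneous_Var[of pdeg c] .
  then show ?thesis
    unfolding quat_form_def by (auto intro!: homogeneous_add homogeneous_diff)
qed

lemma quat_form_scale: "quat_form (\<lambda>c. l * w c) i j = l * quat_form w i j"
  by (simp add: quat_form_def algebra_simps)

lemma quat_form_of_real: "quat_form (\<lambda>c. complex_of_real (w c)) i j = complex_of_real (quat_form w i j)"
  by (simp add: quat_form_def)

section \<open>Injectivity of \<open>alpha\<close>\<close>

lemma alpha_vec_nonzero:
  assumes "v \<noteq> (\<lambda>_. 0)"
  shows "alpha_vec v \<noteq> (\<lambda>_. 0)"
proof
  assume 0: "alpha_vec v = (\<lambda>_. 0)"
  have "v c = 0" for c
  proof (cases c rule: wvar.exhaust)
    case (WE i)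
    have "4 * v (WE i) * v (WE i) = 0"
      unfolding quat_form_alpha_vec[symmetric] 0 by (simp add: quat_form_def)
    then show ?thesis by (simp add: WE)
  qed (use 0 alpha_vec_simps(10-12)[of v] in \<open>simp_all add: fun_eq_iff\<close>)
  with assms show False by auto
qed

text \<open>The products e_i e_j of the two vectors agree up to the factor \<open>l\<close>, so the
  e-parts agree up to a square root of \<open>l\<close>. One nonzero e_j fixes the sign of the root;
  if all e_j vanish, either root will do.\<close>

lemma alpha_vec_inj:
  assumes "alpha_vec v' \<in> wpoint pdeg (alpha_vec v)"
  shows "v' \<in> wpoint wdeg v"
proof -
  obtain l :: complex where l: "l \<noteq> 0"
      "\<And>c. complex_of_real (alpha_vec v' c) = l * complex_of_real (alpha_vec v c)"
    using assms by (auto simp: wpoint_def)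
  \<comment> \<open>For negative \<open>l\<close> the root is imaginary, which weighted points
    allow.\<close>
  define \<mu> where "\<mu> = csqrt l"
  have \<mu>: "\<mu>^2 = l" by (simp add: \<mu>_def)
  have "complex_of_real (quat_form (alpha_vec v') i j) = l * complex_of_real (quat_form (alpha_vec v) i j)"
    for i j
    unfolding quat_form_of_real[symmetric] l(2) quat_form_scale ..
  then have ee: "complex_of_real (v' (WE i)) * complex_of_real (v' (WE j))
      = (\<mu> * complex_of_real (v (WE i))) * (\<mu> * complex_of_real (v (WE j)))" for i j
    by (simp add: quat_form_alpha_vec \<mu>[symmetric] power2_eq_square mult_ac)
  have "\<exists>k. k^2 = l \<and> (\<forall>i. complex_of_real (v' (WE i)) = k * complex_of_real (v (WE i)))"
  proof (cases "\<forall>i. v (WE i) = 0")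
    case True
    with ee have "v' (WE i) = 0" for i
      by (metis mult_eq_0_iff of_real_0 of_real_eq_0_iff)
    with True \<mu> show ?thesis by (intro exI[of _ \<mu>]) simp
  next
    case False
    then obtain j where j: "v (WE j) \<noteq> 0" by auto
    have "(complex_of_real (v' (WE j)))^2 = (\<mu> * complex_of_real (v (WE j)))^2"
      using ee[of j j] by (simp add: power2_eq_square)
    then obtain k where k: "k = \<mu> \<or> k = - \<mu>" "complex_of_real (v' (WE j)) = k * complex_of_real (v (WE j))"
      unfolding power2_eq_iff by (metis mult_minus_left)
    have "k \<noteq> 0" using k(1) \<mu> l(1) by auto
    have "complex_of_real (v' (WE i)) = k * complex_of_real (v (WE i))" for i
    proof -
      have "complex_of_real (v' (WE i)) * (k * complex_of_real (v (WE j)))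
          = (\<mu> * \<mu>) * (complex_of_real (v (WE i)) * complex_of_real (v (WE j)))"
        unfolding k(2)[symmetric] ee by (simp only: mult_ac)
      also have "\<mu> * \<mu> = k * k" using k(1) by auto
      finally have "complex_of_real (v' (WE i)) * (k * complex_of_real (v (WE j)))
          = (k * complex_of_real (v (WE i))) * (k * complex_of_real (v (WE j)))"
        by (simp only: mult_ac)
      then show ?thesis using j \<open>k \<noteq> 0\<close> by simp
    qed
    with k(1) \<mu> show ?thesis by (intro exI[of _ k]) auto
  qed
  then obtain k where k: "k^2 = l" "\<And>i. complex_of_real (v' (WE i)) = k * complex_of_real (v (WE i))"
    by blast
  have "complex_of_real (v' c) = k ^ wdeg c * complex_of_real (v c)" for c
    using l(2)[of "PX _"] l(2)[of "PY _"] l(2)[of PR] k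
    by (cases c rule: wvar.exhaust) (simp_all add: alpha_vec_simps)
  moreover have "k \<noteq> 0" using k(1) l(1) by auto
  ultimately show ?thesis by (auto simp: wpoint_def)
qed

text \<open>A factor of degree 2 is split off: either a variable of degree 2, which is the image of
  a coordinate, or a product e_i e_j, which is the image of a quarter of
  \<open>quat_form\<close>.\<close>

lemma lift_monom:
  "wtdeg wdeg m = 2 * n \<Longrightarrow>
     \<exists>F. homogeneous pdeg n F \<and> psubst alpha_poly F = monom_eval Var m"
proof (induction n arbitrary: m)
  case 0
  have "wdeg i > 0" for i by (cases i) auto
  moreover have "wdeg i = 0" if "i \<in> Poly_Mapping.keys m" for i
    using 0 that by (simp add: wtdeg_def in_keys_iff)
  ultimately have "m = 0"
    by (metis ex_in_conv keys_eq_empty less_irrefl)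
  then show ?case
    by (intro exI[of _ 1]) (simp add: homogeneous_1 psubst.mpoly_hom_simps)
next
  case (Suc n)
  have "\<exists>k l F. m = k + l \<and> wtdeg wdeg k = 2 \<and> homogeneous pdeg 1 F
      \<and> psubst alpha_poly F = monom_eval Var k"
  proof (cases "\<exists>c\<in>Poly_Mapping.keys m. wdeg c = 2")
    case True
    then obtain c where c: "1 \<le> Poly_Mapping.lookup m c" "wdeg c = 2"
      by (auto simp: in_keys_iff Suc_le_eq)
    then obtain k where k: "m = Poly_Mapping.single c 1 + k"
      using single_split by metis
    have "\<exists>F. homogeneous pdeg 1 F \<and> psubst alpha_poly F = Var c"
    proof -
      from c(2) have "\<exists>d. alpha_poly d = Var c"
        by (cases c rule: wvar.exhaust)
          (auto intro: exI[of _ "PX _"] exI[of _ "PY _"] exI[of _ PR])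
      then obtain d where "alpha_poly d = Var c" by blast
      then show ?thesis
        using homogeneous_Var[of pdeg d]
        by (intro exI[of _ "Var d"]) (simp add: psubst.mpoly_hom_simps)
    qed
    with k c show ?thesis
      by (metis monom_eval_single power_one_right wtdeg_single mult.right_neutral)
  next
    case False
    then have E: "\<exists>i. c = WE i" if "c \<in> Poly_Mapping.keys m" for c
      using that by (cases c rule: wvar.exhaust) auto
    have "m \<noteq> 0" using Suc.prems by auto
    then obtain i where i: "1 \<le> Poly_Mapping.lookup m (WE i)"
      using E by (metis in_keys_iff keys_eq_empty ex_in_conv less_one not_le)
    then obtain k where k: "m = Poly_Mapping.single (WE i) 1 + k"
      using single_split by metis
    \<comment> \<open>The remaining degree is odd, so there is a second factor, again some
      \<open>WE j\<close>.\<close>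
    then have "wtdeg wdeg k = 2 * n + 1"
      using Suc.prems by (simp add: wtdeg_add)
    then have "k \<noteq> 0" by auto
    then obtain c where c: "c \<in> Poly_Mapping.keys k"
      by (metis keys_eq_empty ex_in_conv)
    moreover from c have "c \<in> Poly_Mapping.keys m"
      by (simp add: k in_keys_iff lookup_add)
    ultimately obtain j where "1 \<le> Poly_Mapping.lookup k (WE j)"
      using E by (metis in_keys_iff less_one not_le)
    then obtain l where l: "k = Poly_Mapping.single (WE j) 1 + l"
      using single_split by metis
    let ?F = "Const (1/4) * quat_form Var i j :: (pvar, real) mpoly"
    have quarter: "Const (1/4) * (4 * p) = p" for p :: wpoly
    proof -
      have "Const (1/4) * 4 = Const (1/4) * (Const 4 :: wpoly)"
        by (simp add: Const_def)
      also have "\<dots> = 1"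
        by (simp add: psubst.c_1 flip: psubst.c_mult)
      finally show ?thesis by (simp flip: mult.assoc)
    qed
    show ?thesis
    proof (intro exI conjI)
      show "m = (Poly_Mapping.single (WE i) 1 + Poly_Mapping.single (WE j) 1) + l"
        by (simp add: k l add.assoc)
      show "wtdeg wdeg (Poly_Mapping.single (WE i) 1 + Poly_Mapping.single (WE j) 1) = 2"
        by (simp add: wtdeg_add)
      show "homogeneous pdeg 1 ?F"
        by (rule homogeneous_mult[OF homogeneous_Const homogeneous_quat_form]) simp
      show "psubst alpha_poly ?F =
          monom_eval Var (Poly_Mapping.single (WE i) 1 + Poly_Mapping.single (WE j) 1)"
        using quarter[of "ee i * ee j"]
        by (simp add: psubst.mpoly_hom_mult psubst.mpoly_hom_Const quat_form_psubst_alpha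
            monom_eval_add mult.assoc)
    qed
  qed
  then obtain k l F where *: "m = k + l" "wtdeg wdeg k = 2" "homogeneous pdeg 1 F"
    "psubst alpha_poly F = monom_eval Var k" by blast
  then have "wtdeg wdeg l = 2 * n"
    using Suc.prems by (simp add: wtdeg_add)
  from Suc.IH[OF this] obtain G where "homogeneous pdeg n G" "psubst alpha_poly G = monom_eval Var l"
    by blast
  with * show ?case
    by (intro exI[of _ "F * G"])
      (auto intro: homogeneous_mult simp: psubst.mpoly_hom_mult monom_eval_add)
qed

text \<open>The coordinate ring of the projective space maps onto the even part of the weighted one,
  its second Veronese subring.\<close>

lemma lift_even:
  assumes "homogeneous wdeg (2 * n) f"
  shows "\<exists>F. homogeneous pdeg n F \<and> psubst alpha_poly F = f"
proof -
  have "\<exists>F. homogeneous pdeg n F \<and> psubst alpha_poly F = monom_eval Var m"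
    if "m \<in> Poly_Mapping.keys f" for m
    using assms that by (intro lift_monom) (simp add: homogeneous_alt)
  then obtain L where L: "\<And>m. m \<in> Poly_Mapping.keys f \<Longrightarrow> homogeneous pdeg n (L m)"
      "\<And>m. m \<in> Poly_Mapping.keys f \<Longrightarrow> psubst alpha_poly (L m) = monom_eval Var m"
    by metis
  let ?F = "\<Sum>m\<in>Poly_Mapping.keys f. Const (Poly_Mapping.lookup f m) * L m"
  have "homogeneous pdeg n ?F"
    by (intro homogeneous_sum homogeneous_mult[OF homogeneous_Const L(1)]) simp_all
  moreover have "psubst alpha_poly ?F = psubst Var f"
    unfolding mpoly_hom_alt[of Const Var] psubst.mpoly_hom_sum
    by (intro sum.cong refl) (simp add: psubst.mpoly_hom_mult psubst.mpoly_hom_Const L(2))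
  ultimately show ?thesis by (intro exI[of _ ?F]) (simp add: psubst_Var)
qed

subsection \<open>The cone over the compactification\<close>

text \<open>The affine cone over the compactification, including the vertex 0, as a set of vectors
  rather than of classes.\<close>

definition SE3_cone :: "(wvar \<Rightarrow> real) set" where
  "SE3_cone = {v. \<forall>g\<in>set generators. peval v g = 0}"

lemma cone_iff:
  "v \<in> SE3_cone \<longleftrightarrow>
    (v (WX 3) + v (WY 3)) * v (WE 3) + (v (WX 2) + v (WY 2)) * v (WE 2)
      + (v (WX 1) + v (WY 1)) * v (WE 1) = 0 \<and>
    (v (WY 2) - v (WX 2)) * v (WE 3) - (v (WY 3) - v (WX 3)) * v (WE 2)
      + v (WE 0) * (v (WX 1) + v (WY 1)) = 0 \<and>
    (v (WY 1) - v (WX 1)) * v (WE 3) - (v (WY 3) - v (WX 3)) * v (WE 1)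
      - v (WE 0) * (v (WX 2) + v (WY 2)) = 0 \<and>
    (v (WY 1) - v (WX 1)) * v (WE 2) - (v (WY 2) - v (WX 2)) * v (WE 1)
      + v (WE 0) * (v (WX 3) + v (WY 3)) = 0 \<and>
    (v (WY 1))^2 + (v (WY 2))^2 + (v (WY 3))^2 - (v (WX 1))^2 - (v (WX 2))^2 - (v (WX 3))^2 = 0 \<and>
    (v (WY 1))^2 + (v (WY 2))^2 + (v (WY 3))^2
      - v WR * ((v (WE 0))^2 + (v (WE 1))^2 + (v (WE 2))^2 + (v (WE 3))^2) = 0"
  unfolding SE3_cone_def generators_explicit quartic_def
  by (simp add: peval.mpoly_hom_simps)

lemma homogeneous_generators: "\<forall>g\<in>set generators. \<exists>n. homogeneous wdeg n g"
proof -
  note h = homogeneous_intros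
  have "homogeneous wdeg 3 ((xx 3 + yy 3) * ee 3 + (xx 2 + yy 2) * ee 2 + (xx 1 + yy 1) * ee 1)"
    "homogeneous wdeg 3 ((yy 2 - xx 2) * ee 3 - (yy 3 - xx 3) * ee 2 + ee 0 * (xx 1 + yy 1))"
    "homogeneous wdeg 3 ((yy 1 - xx 1) * ee 3 - (yy 3 - xx 3) * ee 1 - ee 0 * (xx 2 + yy 2))"
    "homogeneous wdeg 3 ((yy 1 - xx 1) * ee 2 - (yy 2 - xx 2) * ee 1 + ee 0 * (xx 3 + yy 3))"
    "homogeneous wdeg 4 ((yy 1)^2 + (yy 2)^2 + (yy 3)^2 - (xx 1)^2 - (xx 2)^2 - (xx 3)^2)"
    "homogeneous wdeg 4 quartic"
    unfolding quartic_def by ((rule h | simp)+)[6]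
  then show ?thesis unfolding generators_explicit by auto
qed

lemma cone_wpoint:
  assumes "w \<in> wpoint wdeg v"
  shows "w \<in> SE3_cone \<longleftrightarrow> v \<in> SE3_cone"
proof -
  have "peval w g = 0 \<longleftrightarrow> peval v g = 0" if "g \<in> set generators" for g
    using homogeneous_generators that homogeneous_wpoint_zero_iff[OF _ assms] by blast
  then show ?thesis by (auto simp: SE3_cone_def)
qed

lemma cone_gen_ideal: "v \<in> SE3_cone \<Longrightarrow> f \<in> gen_ideal \<Longrightarrow> peval v f = 0"
  unfolding gen_ideal_def by (erule peval_ideal_generated) (simp add: SE3_cone_def)

text \<open>For u = s w and v = e x w, the products u.v and e.v are triple products with a repeated
  vector, and e0 v = s (e x w) = e x u. The coordinate \<open>WR\<close> is the solution of the
  quartic.\<close>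

lemma curve_in_cone: "curve n \<in> SE3_cone"
proof -
  \<comment> \<open>Factoring the bases makes the coordinates other than \<open>WR\<close>
    polynomials in \<open>s\<close>, the e_i and the w_i.\<close>
  have *: "(33::real)^n = 3^n * 11^n" "(87::real)^n = 3^n * 29^n" "(123::real)^n = 3^n * 41^n"
    "(205::real)^n = 5^n * 41^n" "(203::real)^n = 7^n * 29^n" "(77::real)^n = 7^n * 11^n"
    "(82::real)^n = 2^n * 41^n" "(58::real)^n = 2^n * 29^n" "(55::real)^n = 5^n * 11^n"
    by (simp_all flip: power_mult_distrib)
  have "(3^n)^2 + (2^n)^2 + (5^n)^2 + (7^n)^2 > (0::real)"
    by (intro add_pos_pos) simp_all
  then have N: "(3^n)^2 + (2^n)^2 + (5^n)^2 + (7^n)^2 \<noteq> (0::real)" by simp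
  have r: "curve n WR * ((3^n)^2 + (2^n)^2 + (5^n)^2 + (7^n)^2) =
     ((33^n)^2 + (87^n)^2 + (123^n)^2 + (205^n - 203^n)^2 + (77^n - 82^n)^2 + (58^n - 55^n)^2) / 4"
  proof -
    have "X / (4 * Y) * Y = X / 4" if "Y \<noteq> 0" for X Y :: real
      using that by simp
    from this[OF N] show ?thesis
      by (simp only: curve.simps entry_curve.simps)
  qed
  define s e1 e2 e3 w1 w2 w3 where d: "s = (3::real)^n" "e1 = (2::real)^n" "e2 = (5::real)^n"
    "e3 = (7::real)^n" "w1 = (11::real)^n" "w2 = (29::real)^n" "w3 = (41::real)^n"
  have c: "curve n (WE 0) = s" "curve n (WE 1) = e1" "curve n (WE 2) = e2" "curve n (WE 3) = e3"
    "curve n (WX 1) = (e2 * w3 - e3 * w2 - s * w1) / 2"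
    "curve n (WX 2) = (e3 * w1 - e1 * w3 - s * w2) / 2"
    "curve n (WX 3) = (e1 * w2 - e2 * w1 - s * w3) / 2"
    "curve n (WY 1) = (e2 * w3 - e3 * w2 + s * w1) / 2"
    "curve n (WY 2) = (e3 * w1 - e1 * w3 + s * w2) / 2"
    "curve n (WY 3) = (e1 * w2 - e2 * w1 + s * w3) / 2"
    by (simp_all add: * d)
  show ?thesis
    unfolding cone_iff c r[unfolded * d[symmetric]]
    by (simp add: field_simps power2_eq_square)
qed

text \<open>The curve stays where h is nonzero, so it suffices to test \<open>f\<close> on the part
  of the cone that comes from isometries.\<close>

lemma cone_vanish_imp_gen_ideal:
  assumes "\<And>v. v \<in> SE3_cone \<Longrightarrow> alpha_vec v PH \<noteq> 0 \<Longrightarrow> peval v f = 0"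
  shows "f \<in> gen_ideal"
proof (rule vanish_on_curve_imp_gen_ideal)
  fix n
  have "alpha_vec (curve n) PH = (3^n)^2 + (2^n)^2 + (5^n)^2 + (7^n)^2"
    by (simp add: alpha_vec_simps)
  also have "\<dots> > 0" by (intro add_pos_pos) simp_all
  finally show "peval (curve n) f = 0"
    by (intro assms curve_in_cone) simp
  show "peval (curve n) g = 0" if "g \<in> set generators" for g
    using curve_in_cone that by (simp add: SE3_cone_def)
qed

subsection \<open>Rotations\<close>

lemma phi_coords_simps:
  "phi_coords A y (PA i j) = A $ i $ j" "phi_coords A y (PX i) = - (transpose A *v y) $ i"
  "phi_coords A y (PY i) = y $ i" "phi_coords A y PR = y \<bullet> y" "phi_coords A y PH = 1"
  by (simp_all add: phi_coords_def)

text \<open>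
  On the cone, \<open>e x + y e = 0\<close> in quaternions. Multiplied by the conjugate of \<open>e\<close>, this says that
  \<open>|e|\<^sup>2 x\<close> is the negative of the transpose of \<open>E(e)\<close> applied to \<open>y\<close>.
\<close>

lemma cone_to_SE3:
  assumes "v \<in> SE3_cone" "alpha_vec v PH \<noteq> 0"
  shows "\<exists>g\<in>SE3. wpoint pdeg (alpha_vec v) = phi g"
proof -
  let ?N = "alpha_vec v PH"
  let ?a = "\<lambda>i j. alpha_vec v (PA i j)"
  define A :: "real^3^3" where "A = (\<chi> i j. ?a i j / ?N)"
  define y :: "real^3" where "y = (\<chi> i. v (WY i) / ?N)"
  \<comment> \<open>The columns of E(e) are orthogonal, of length \<open>?N\<close>, the square of
    |e|.\<close>
  have AA: "(\<Sum>k\<in>UNIV. ?a k i * ?a k j) = (if i = j then ?N * ?N else 0)" for i j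
  proof -
    have "\<forall>i j. (\<Sum>k\<in>UNIV. ?a k i * ?a k j) = (if i = j then ?N * ?N else 0)"
      unfolding forall_3 sum_3 by (simp add: alpha_vec_simps algebra_simps power2_eq_square)
    then show ?thesis by blast
  qed
  have "orthogonal_matrix A"
    unfolding orthogonal_matrix
    using assms(2)
    by (simp add: vec_eq_iff matrix_matrix_mult_def transpose_def A_def mat_def AA flip: sum_divide_distrib)
  moreover have "det A = 1"
  proof -
    have "det A = (?a 1 1 * ?a 2 2 * ?a 3 3 + ?a 1 2 * ?a 2 3 * ?a 3 1 + ?a 1 3 * ?a 2 1 * ?a 3 2
        - ?a 1 1 * ?a 2 3 * ?a 3 2 - ?a 1 2 * ?a 2 1 * ?a 3 3 - ?a 1 3 * ?a 2 2 * ?a 3 1) / (?N * ?N * ?N)"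
      unfolding det_3 by (simp add: A_def diff_divide_distrib add_divide_distrib)
    also have "?a 1 1 * ?a 2 2 * ?a 3 3 + ?a 1 2 * ?a 2 3 * ?a 3 1 + ?a 1 3 * ?a 2 1 * ?a 3 2
        - ?a 1 1 * ?a 2 3 * ?a 3 2 - ?a 1 2 * ?a 2 1 * ?a 3 3 - ?a 1 3 * ?a 2 2 * ?a 3 1 = ?N * ?N * ?N"
      by (simp add: alpha_vec_simps algebra_simps power2_eq_square)
    finally show ?thesis using assms(2) by simp
  qed
  ultimately have "rotation_matrix A"
    by (simp add: rotation_matrix_def)
  then have "(\<lambda>u. A *v u + y) \<in> SE3"
    by (auto simp: SE3_def)
  moreover have scale: "alpha_vec v c = ?N * phi_coords A y c" for c
  proof (cases c)
    case (PX i)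
    define p0 p1 p2 p3 where p:
      "p0 = (v (WX 3) + v (WY 3)) * v (WE 3) + (v (WX 2) + v (WY 2)) * v (WE 2)
        + (v (WX 1) + v (WY 1)) * v (WE 1)"
      "p1 = (v (WY 2) - v (WX 2)) * v (WE 3) - (v (WY 3) - v (WX 3)) * v (WE 2)
        + v (WE 0) * (v (WX 1) + v (WY 1))"
      "p2 = (v (WY 1) - v (WX 1)) * v (WE 3) - (v (WY 3) - v (WX 3)) * v (WE 1)
        - v (WE 0) * (v (WX 2) + v (WY 2))"
      "p3 = (v (WY 1) - v (WX 1)) * v (WE 2) - (v (WY 2) - v (WX 2)) * v (WE 1)
        + v (WE 0) * (v (WX 3) + v (WY 3))"
    have p_eq: "p0 = 0" "p1 = 0" "p2 = 0" "p3 = 0"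
      using assms(1) unfolding cone_iff p by blast+
    \<comment> \<open>Each component of |e|^2 x + E(e)^t y is a combination of the four cubic
      Pfaffians with coefficients e_i up to sign.\<close>
    have "?N * v (WX 1) + (?a 1 1 * v (WY 1) + ?a 2 1 * v (WY 2) + ?a 3 1 * v (WY 3))
        = v (WE 0) * p1 + v (WE 1) * p0 - (v (WE 2) * p3 + v (WE 3) * p2)"
      "?N * v (WX 2) + (?a 1 2 * v (WY 1) + ?a 2 2 * v (WY 2) + ?a 3 2 * v (WY 3))
        = - v (WE 0) * p2 + v (WE 2) * p0 - (v (WE 3) * p1 - v (WE 1) * p3)"
      "?N * v (WX 3) + (?a 1 3 * v (WY 1) + ?a 2 3 * v (WY 2) + ?a 3 3 * v (WY 3))
        = v (WE 0) * p3 + v (WE 3) * p0 - (- v (WE 1) * p2 - v (WE 2) * p1)"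
      unfolding p by (simp_all add: alpha_vec_simps algebra_simps power2_eq_square)
    then have "\<forall>i. ?N * v (WX i) + (\<Sum>k\<in>UNIV. ?a k i * v (WY k)) = 0"
      unfolding forall_3 sum_3 p_eq by simp
    then have "?N * v (WX i) = - (\<Sum>k\<in>UNIV. ?a k i * v (WY k))"
      by (simp add: eq_neg_iff_add_eq_0)
    then have "v (WX i) = - (\<Sum>k\<in>UNIV. ?a k i * v (WY k)) / ?N"
      using assms(2) by (metis nonzero_mult_div_cancel_left)
    then show ?thesis
      using assms(2)
      by (simp add: PX phi_coords_simps alpha_vec_simps(10) matrix_vector_mult_def transpose_def
          A_def y_def flip: sum_divide_distrib)
  next
    case PR
    have "v WR * ?N = (v (WY 1))^2 + (v (WY 2))^2 + (v (WY 3))^2"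
      using assms(1) unfolding cone_iff alpha_vec_simps by linarith
    also have "\<dots> = (y \<bullet> y) * ?N * ?N"
      using assms(2) by (simp add: y_def inner_vec_def sum_3 field_simps power2_eq_square)
    finally show ?thesis
      using assms(2) by (simp add: PR phi_coords_simps alpha_vec_simps)
  qed (use assms(2) in \<open>simp_all add: phi_coords_simps A_def y_def alpha_vec_simps(11)\<close>)
  have "alpha_vec v = (\<lambda>c. ?N ^ pdeg c * phi_coords A y c)"
  proof
    show "alpha_vec v c = ?N ^ pdeg c * phi_coords A y c" for c
      using scale[of c] by (simp only: power_one_right)
  qed
  then have "alpha_vec v \<in> wpoint pdeg (phi_coords A y)"
    by (rule ssubst) (rule wpoint_real_scale[OF assms(2)])
  then have "wpoint pdeg (alpha_vec v) = phi (\<lambda>u. A *v u + y)"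
    unfolding phi_affine by (rule wpoint_eq)
  ultimately show ?thesis by blast
qed

text \<open>
  The quadrics in the first set make the symmetric matrix \<open>quat_form\<close> have rank at most one.
\<close>

definition quadrics :: "(pvar, real) mpoly set" where
  "quadrics =
    {quat_form Var i i * quat_form Var j k - quat_form Var i j * quat_form Var i k | i j k. True} \<union>
    {Var (PA i 1) * Var (PX 1) + Var (PA i 2) * Var (PX 2) + Var (PA i 3) * Var (PX 3)
      + Var PH * Var (PY i) | i. True} \<union>
    {(Var (PX 1))^2 + (Var (PX 2))^2 + (Var (PX 3))^2
      - ((Var (PY 1))^2 + (Var (PY 2))^2 + (Var (PY 3))^2),
     (Var (PY 1))^2 + (Var (PY 2))^2 + (Var (PY 3))^2 - Var PR * Var PH}"

lemma quadrics_vanish_iff: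
  "(\<forall>q\<in>quadrics. peval w q = 0) \<longleftrightarrow>
    (\<forall>i j k. quat_form w i i * quat_form w j k = quat_form w i j * quat_form w i k) \<and>
    (\<forall>i. w (PA i 1) * w (PX 1) + w (PA i 2) * w (PX 2) + w (PA i 3) * w (PX 3) + w PH * w (PY i) = 0) \<and>
    (w (PX 1))^2 + (w (PX 2))^2 + (w (PX 3))^2 = (w (PY 1))^2 + (w (PY 2))^2 + (w (PY 3))^2 \<and>
    (w (PY 1))^2 + (w (PY 2))^2 + (w (PY 3))^2 = w PR * w PH"
proof -
  have "(\<forall>q\<in>{f i j k | i j k. True} \<union> {g i | i. True} \<union> {a, b}. peval w q = 0) \<longleftrightarrow>
    (\<forall>i j k. peval w (f i j k) = 0) \<and> (\<forall>i. peval w (g i) = 0) \<and> peval w a = 0 \<and> peval w b = 0"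
    for f :: "4 \<Rightarrow> 4 \<Rightarrow> 4 \<Rightarrow> (pvar, real) mpoly" and g :: "3 \<Rightarrow> (pvar, real) mpoly" and a b
    by blast
  note eq = this
  show ?thesis
    unfolding quadrics_def eq by (simp add: peval.mpoly_hom_simps peval_quat_form)
qed

lemma homogeneous_quadrics: "q \<in> quadrics \<Longrightarrow> homogeneous pdeg 2 q"
proof -
  have h1: "homogeneous pdeg 1 (Var c)" for c
    using homogeneous_Var[of pdeg c] .
  have "homogeneous pdeg 2 (quat_form Var i j * quat_form Var k l)" for i j k l
    by (rule homogeneous_mult[OF homogeneous_quat_form homogeneous_quat_form]) simp
  moreover have "homogeneous pdeg 2 (Var c * Var d)" for c d
    by (rule homogeneous_mult[OF h1 h1]) simp
  moreover have "homogeneous pdeg 2 ((Var c)^2)" for c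
    by (rule homogeneous_power[OF h1]) simp
  ultimately show "q \<in> quadrics \<Longrightarrow> homogeneous pdeg 2 q"
    unfolding quadrics_def
    by (elim UnE insertE emptyE CollectE exE conjE; simp only:; intro homogeneous_add homogeneous_diff)
qed

text \<open>A real symmetric matrix of rank at most one is 4 e e^t up to a sign \<open>l\<close>,
  which is needed because e is real. The remaining quadrics then give the relations of the
  cone.\<close>

lemma quadrics_imp_cone:
  assumes "\<forall>q\<in>quadrics. peval w q = 0"
  shows "\<exists>v l. v \<in> SE3_cone \<and> (l = 1 \<or> l = -1) \<and> w = (\<lambda>c. l * alpha_vec v c)"
proof -
  let ?S = "quat_form w"
  have S: "?S i i * ?S j k = ?S i j * ?S i k" for i j k
    using assms unfolding quadrics_vanish_iff by blast
  have lin: "w (PA i 1) * w (PX 1) + w (PA i 2) * w (PX 2) + w (PA i 3) * w (PX 3) + w PH * w (PY i) = 0"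
    for i using assms unfolding quadrics_vanish_iff by blast
  have sq: "(w (PX 1))^2 + (w (PX 2))^2 + (w (PX 3))^2 = (w (PY 1))^2 + (w (PY 2))^2 + (w (PY 3))^2"
    "(w (PY 1))^2 + (w (PY 2))^2 + (w (PY 3))^2 = w PR * w PH"
    using assms unfolding quadrics_vanish_iff by blast+
  obtain e :: "4 \<Rightarrow> real" and l :: real where e: "l = 1 \<or> l = -1" "\<And>j k. ?S j k = l * (4 * e j * e k)"
  proof (cases "\<exists>i. ?S i i \<noteq> 0")
    case True
    then obtain i where i: "?S i i \<noteq> 0" by blast
    define l where "l = sgn (?S i i)"
    \<comment> \<open>A row with nonzero diagonal entry is proportional to e, and this factor
      normalizes it.\<close>
    define e where "e j = ?S i j / (2 * sqrt \<bar>?S i i\<bar>)" for j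
    have "?S j k = l * (4 * e j * e k)" for j k
    proof -
      have "4 * e j * e k = ?S i j * ?S i k / \<bar>?S i i\<bar>"
        using i by (simp add: e_def field_simps)
      also have "\<dots> = ?S i i * ?S j k / \<bar>?S i i\<bar>"
        by (simp add: S[of i j k])
      also have "\<dots> = l * ?S j k"
        using i by (simp add: l_def sgn_real_def)
      finally show ?thesis
        using i by (simp add: l_def sgn_real_def)
    qed
    moreover have "l = 1 \<or> l = -1"
      using i by (simp add: l_def sgn_real_def)
    ultimately show thesis by (intro that) auto
  next
    case False
    \<comment> \<open>The square of \<open>?S j k\<close> is \<open>?S j j * ?S k k\<close>, so a
      zero diagonal forces the zero matrix.\<close>
    then have "?S j k = 0" for j k
      using S[of j k k] by (metis mult_eq_0_iff)
    then show thesis by (intro that[of 1 "\<lambda>_. 0"]) auto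
  qed
  \<comment> \<open>The sign also multiplies x, y and r, so that \<open>alpha_vec v\<close> is
    \<open>l\<close> times \<open>w\<close> in all coordinates.\<close>
  define v where "v c = (case c of WE i \<Rightarrow> e i | WX i \<Rightarrow> l * w (PX i) | WY i \<Rightarrow> l * w (PY i) | WR \<Rightarrow> l * w PR)" for c
  have v: "v (WE i) = e i" "v (WX j) = l * w (PX j)" "v (WY j) = l * w (PY j)" "v WR = l * w PR" for i j
    by (simp_all add: v_def)
  have ll: "l * l = 1" using e(1) by auto
  have S': "l * ?S j k = 4 * e j * e k" for j k
    unfolding e(2) using ll by (simp flip: mult.assoc)
  have PAH: "\<forall>i j. alpha_vec v (PA i j) = l * w (PA i j)" "alpha_vec v PH = l * w PH"
    using S'[of 0 0] S'[of 0 1] S'[of 0 2] S'[of 0 3] S'[of 1 1] S'[of 1 2] S'[of 1 3]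
      S'[of 2 2] S'[of 2 3] S'[of 3 3]
    unfolding forall_3 alpha_vec_simps v
    by (simp_all add: quat_form_def algebra_simps power2_eq_square)
  have av: "alpha_vec v c = l * w c" for c
    by (cases c) (simp_all add: PAH alpha_vec_simps(10-12) v)
  have w: "w c = l * alpha_vec v c" for c
    unfolding av using ll by (simp flip: mult.assoc)
  let ?N = "alpha_vec v PH"
  define R where "R i = alpha_vec v (PA i 1) * v (WX 1) + alpha_vec v (PA i 2) * v (WX 2)
      + alpha_vec v (PA i 3) * v (WX 3) + ?N * v (WY i)" for i
  have R: "R i = 0" for i
    using lin[of i] ll unfolding R_def av v by (simp add: mult_ac flip: distrib_left)
  define p0 p1 p2 p3 where p:
    "p0 = (v (WX 3) + v (WY 3)) * v (WE 3) + (v (WX 2) + v (WY 2)) * v (WE 2)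
      + (v (WX 1) + v (WY 1)) * v (WE 1)"
    "p1 = (v (WY 2) - v (WX 2)) * v (WE 3) - (v (WY 3) - v (WX 3)) * v (WE 2)
      + v (WE 0) * (v (WX 1) + v (WY 1))"
    "p2 = (v (WY 1) - v (WX 1)) * v (WE 3) - (v (WY 3) - v (WX 3)) * v (WE 1)
      - v (WE 0) * (v (WX 2) + v (WY 2))"
    "p3 = (v (WY 1) - v (WX 1)) * v (WE 2) - (v (WY 2) - v (WX 2)) * v (WE 1)
      + v (WE 0) * (v (WX 3) + v (WY 3))"
  \<comment> \<open>The vector \<open>R\<close> is E(e) x + |e|^2 y; multiplying it by e gives the
    Pfaffians times |e|^2. If |e| = 0 they vanish anyway, being linear in e.\<close>
  have "?N * p0 = v (WE 1) * R 1 + v (WE 2) * R 2 + v (WE 3) * R 3"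
    "?N * p1 = v (WE 0) * R 1 + v (WE 3) * R 2 - v (WE 2) * R 3"
    "?N * p2 = v (WE 3) * R 1 - v (WE 1) * R 3 - v (WE 0) * R 2"
    "?N * p3 = v (WE 2) * R 1 - v (WE 1) * R 2 + v (WE 0) * R 3"
    unfolding p R_def by (simp_all add: alpha_vec_simps algebra_simps power2_eq_square)
  then have Np: "?N * p0 = 0" "?N * p1 = 0" "?N * p2 = 0" "?N * p3 = 0"
    unfolding R by simp_all
  have "p0 = 0 \<and> p1 = 0 \<and> p2 = 0 \<and> p3 = 0"
  proof (cases "?N = 0")
    case True
    then have "v (WE 0) = 0 \<and> v (WE 1) = 0 \<and> v (WE 2) = 0 \<and> v (WE 3) = 0"
      unfolding alpha_vec_simps by (simp add: add_nonneg_eq_0_iff)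
    then show ?thesis unfolding p by simp
  qed (use Np in simp)
  moreover have "(v (WX 1))^2 + (v (WX 2))^2 + (v (WX 3))^2 = (v (WY 1))^2 + (v (WY 2))^2 + (v (WY 3))^2"
    "(v (WY 1))^2 + (v (WY 2))^2 + (v (WY 3))^2 = v WR * ?N"
    using sq ll unfolding av v by (simp_all add: power_mult_distrib power2_eq_square mult_ac flip: distrib_left)
  ultimately have "v \<in> SE3_cone"
    unfolding cone_iff p alpha_vec_simps by linarith
  with e(1) w show ?thesis by blast
qed

section \<open>Rotations satisfy the quadrics\<close>

lemma rotation_cofactors:
  fixes A :: "real^3^3"
  assumes "rotation_matrix A"
  shows "A$2$1 * A$3$2 - A$3$1 * A$2$2 = A$1$3" "A$3$1 * A$1$2 - A$1$1 * A$3$2 = A$2$3"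
    "A$1$1 * A$2$2 - A$2$1 * A$1$2 = A$3$3" "A$2$2 * A$3$3 - A$3$2 * A$2$3 = A$1$1"
    "A$3$2 * A$1$3 - A$1$2 * A$3$3 = A$2$1" "A$1$2 * A$2$3 - A$2$2 * A$1$3 = A$3$1"
    "A$2$3 * A$3$1 - A$3$3 * A$2$1 = A$1$2" "A$3$3 * A$1$1 - A$1$3 * A$3$1 = A$2$2"
    "A$1$3 * A$2$1 - A$2$3 * A$1$1 = A$3$2"
proof -
  \<comment> \<open>Rotations preserve cross products. On the standard basis this says that each
    column of \<open>A\<close> is the cross product of the other two, in cyclic order.\<close>
  have c: "cross3 (A *v vector [1,0,0]) (A *v vector [0,1,0]) = A *v (cross3 (vector [1,0,0]) (vector [0,1,0]))"
    "cross3 (A *v vector [0,1,0]) (A *v vector [0,0,1]) = A *v (cross3 (vector [0,1,0]) (vector [0,0,1]))"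
    "cross3 (A *v vector [0,0,1]) (A *v vector [1,0,0]) = A *v (cross3 (vector [0,0,1]) (vector [1,0,0]))"
    by (rule cross_rotation_matrix[OF assms])+
  note c = c[unfolded vec_eq_iff forall_3 cross3_def matrix_vector_mult_def, simplified sum_3 vec_lambda_beta vector_3, simplified]
  show "A$2$1 * A$3$2 - A$3$1 * A$2$2 = A$1$3" "A$3$1 * A$1$2 - A$1$1 * A$3$2 = A$2$3"
    "A$1$1 * A$2$2 - A$2$1 * A$1$2 = A$3$3" "A$2$2 * A$3$3 - A$3$2 * A$2$3 = A$1$1"
    "A$3$2 * A$1$3 - A$1$2 * A$3$3 = A$2$1" "A$1$2 * A$2$3 - A$2$2 * A$1$3 = A$3$1"
    "A$2$3 * A$3$1 - A$3$3 * A$2$1 = A$1$2" "A$3$3 * A$1$1 - A$1$3 * A$3$1 = A$2$2"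
    "A$1$3 * A$2$1 - A$2$3 * A$1$1 = A$3$2"
    using c by (simp_all add: algebra_simps)
qed

text \<open>With h = 1, each of these minors is a linear combination of the orthogonality and
  cofactor relations, so linear arithmetic with the products of entries as unknowns proves
  it.\<close>

lemma quat_form_minors:
  fixes w :: "pvar \<Rightarrow> real"
  assumes "w PH = 1"
  and cols: "\<And>i j. w (PA 1 i) * w (PA 1 j) + w (PA 2 i) * w (PA 2 j) + w (PA 3 i) * w (PA 3 j) = (if i = j then 1 else 0)"
  and rows: "\<And>i j. w (PA i 1) * w (PA j 1) + w (PA i 2) * w (PA j 2) + w (PA i 3) * w (PA j 3) = (if i = j then 1 else 0)"
  and cof:
   "w (PA 2 1) * w (PA 3 2) - w (PA 3 1) * w (PA 2 2) = w (PA 1 3)"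
   "w (PA 3 1) * w (PA 1 2) - w (PA 1 1) * w (PA 3 2) = w (PA 2 3)"
   "w (PA 1 1) * w (PA 2 2) - w (PA 2 1) * w (PA 1 2) = w (PA 3 3)"
   "w (PA 2 2) * w (PA 3 3) - w (PA 3 2) * w (PA 2 3) = w (PA 1 1)"
   "w (PA 3 2) * w (PA 1 3) - w (PA 1 2) * w (PA 3 3) = w (PA 2 1)"
   "w (PA 1 2) * w (PA 2 3) - w (PA 2 2) * w (PA 1 3) = w (PA 3 1)"
   "w (PA 2 3) * w (PA 3 1) - w (PA 3 3) * w (PA 2 1) = w (PA 1 2)"
   "w (PA 3 3) * w (PA 1 1) - w (PA 1 3) * w (PA 3 1) = w (PA 2 2)"
   "w (PA 1 3) * w (PA 2 1) - w (PA 2 3) * w (PA 1 1) = w (PA 3 2)"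
  shows "quat_form w i i * quat_form w j k = quat_form w i j * quat_form w i k"
proof -
  note facts = cols[of 1 1] cols[of 2 2] cols[of 3 3] cols[of 1 2] cols[of 1 3] cols[of 2 3]
    rows[of 1 1] rows[of 2 2] rows[of 3 3] rows[of 1 2] rows[of 1 3] rows[of 2 3] cof
  note facts' = facts[simplified]
  have "\<forall>i j k. quat_form w i i * quat_form w j k = quat_form w i j * quat_form w i k"
    unfolding forall_4_from_0
    by (intro conjI; simp add: quat_form_def assms(1);
        use facts' in \<open>simp add: algebra_simps; linarith\<close>)
  then show ?thesis by blast
qed

text \<open>For x = - A^t y, orthogonality of \<open>A\<close> gives A x = - y and |x| =
  |y|.\<close>

lemma phi_coords_quadrics:
  assumes "rotation_matrix A"
  shows "\<forall>q\<in>quadrics. peval (phi_coords A y) q = 0"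
proof -
  have orth: "transpose A ** A = mat 1" "A ** transpose A = mat 1"
    using assms by (simp_all add: rotation_matrix_def orthogonal_matrix_def)
  define x where "x = - (transpose A *v y)"
  have px: "phi_coords A y (PX i) = x $ i" for i
    by (simp add: x_def phi_coords_simps)
  have minors: "\<forall>i j k. quat_form (phi_coords A y) i i * quat_form (phi_coords A y) j k
      = quat_form (phi_coords A y) i j * quat_form (phi_coords A y) i k"
  proof (intro allI quat_form_minors)
    fix i j :: 3
    show "phi_coords A y (PA 1 i) * phi_coords A y (PA 1 j) + phi_coords A y (PA 2 i) * phi_coords A y (PA 2 j)
        + phi_coords A y (PA 3 i) * phi_coords A y (PA 3 j) = (if i = j then 1 else 0)"
      using arg_cong[OF orth(1), of "\<lambda>B. B $ i $ j"]
      by (simp add: phi_coords_simps matrix_matrix_mult_def transpose_def mat_def sum_3)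
    show "phi_coords A y (PA i 1) * phi_coords A y (PA j 1) + phi_coords A y (PA i 2) * phi_coords A y (PA j 2)
        + phi_coords A y (PA i 3) * phi_coords A y (PA j 3) = (if i = j then 1 else 0)"
      using arg_cong[OF orth(2), of "\<lambda>B. B $ i $ j"]
      by (simp add: phi_coords_simps matrix_matrix_mult_def transpose_def mat_def sum_3)
  qed (simp_all add: phi_coords_simps rotation_cofactors[OF assms])
  have AAy: "A *v (transpose A *v y) = y"
    by (simp only: matrix_vector_mul_assoc orth(2) matrix_vector_mul_lid)
  then have "A *v x = - y"
    unfolding x_def linear_neg[OF matrix_vector_mul_linear] by simp
  then have "(A *v x) $ i + y $ i = 0" for i by simp
  then have lin: "\<forall>i. A $ i $ 1 * x $ 1 + A $ i $ 2 * x $ 2 + A $ i $ 3 * x $ 3 + y $ i = 0"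
    by (simp add: matrix_vector_mult_def sum_3)
  have "x \<bullet> x = y \<bullet> y"
  proof -
    have "x \<bullet> x = (y v* A) \<bullet> (transpose A *v y)" by (simp add: x_def)
    also have "\<dots> = y \<bullet> (A *v (transpose A *v y))" by (rule dot_lmul_matrix)
    finally show ?thesis by (simp only: AAy)
  qed
  then have sq: "(x $ 1)^2 + (x $ 2)^2 + (x $ 3)^2 = (y $ 1)^2 + (y $ 2)^2 + (y $ 3)^2"
    "(y $ 1)^2 + (y $ 2)^2 + (y $ 3)^2 = y \<bullet> y"
    by (simp_all add: inner_vec_def sum_3 power2_eq_square)
  show ?thesis
    unfolding quadrics_vanish_iff px phi_coords_simps(1,3-5) using minors lin sq by simp
qed

text \<open>That every rotation comes from a quaternion follows from the quadrics. The sign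
  \<open>l\<close> does not change the point, and h = 1 excludes e = 0.\<close>

lemma phi_cone:
  assumes "g \<in> SE3"
  obtains v where "v \<in> SE3_cone" "alpha_vec v PH \<noteq> 0" "phi g = wpoint pdeg (alpha_vec v)"
proof -
  obtain A y where A: "rotation_matrix A" "g = (\<lambda>u. A *v u + y)"
    using assms by (auto simp: SE3_def)
  obtain v l where v: "v \<in> SE3_cone" "l = 1 \<or> l = -1" "phi_coords A y = (\<lambda>c. l * alpha_vec v c)"
    using quadrics_imp_cone[OF phi_coords_quadrics[OF A(1)]] by metis
  have "phi_coords A y PH = l * alpha_vec v PH" by (simp only: v(3))
  then have "alpha_vec v PH \<noteq> 0" by (auto simp: phi_coords_simps)
  moreover have "phi_coords A y \<in> wpoint pdeg (alpha_vec v)"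
    using wpoint_real_scale[of l pdeg "alpha_vec v"] v(2) by (auto simp: v(3))
  then have "phi g = wpoint pdeg (alpha_vec v)"
    unfolding A(2) phi_affine by (rule wpoint_eq)
  ultimately show thesis using v(1) by (intro that)
qed

subsection \<open>The compactification as a subset of the weighted projective space\<close>

definition weighted_closure :: "(wvar \<Rightarrow> real) set set" where
  "weighted_closure = wpoint wdeg ` {v \<in> SE3_cone. v \<noteq> (\<lambda>_. 0)}"

lemma weighted_closureE:
  assumes "q \<in> weighted_closure"
  obtains v where "q = wpoint wdeg v" "v \<in> SE3_cone" "v \<noteq> (\<lambda>_. 0)"
  using assms by (auto simp: weighted_closure_def)

lemma weighted_closure_zero_locus: "weighted_closure = zero_locus wdeg (set generators)"
proof -
  have "wpoint wdeg v \<in> zero_locus wdeg (set generators) \<longleftrightarrow> v \<in> SE3_cone"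
    if "v \<noteq> (\<lambda>_. 0)" for v
    using wpoint_in_zero_locus_iff[OF homogeneous_generators that] by (simp add: SE3_cone_def)
  moreover have "zero_locus wdeg (set generators) \<subseteq> wproj wdeg"
    by (auto simp: zero_locus_def)
  ultimately show ?thesis
    by (fastforce simp: weighted_closure_def wproj_def)
qed

lemma alpha_vec_PH_imp_nonzero: "alpha_vec v PH \<noteq> 0 \<Longrightarrow> v \<noteq> (\<lambda>_. 0)"
  by (auto simp: alpha_vec_simps)

text \<open>Vanishing on the part where h is nonzero already forces membership in
  \<open>gen_ideal\<close>. Conversely, the generators are forms that vanish on every
  representative.\<close>

lemma vanishing_ideal_weighted_closure: "vanishing_ideal wdeg weighted_closure = gen_ideal"
proof
  show "vanishing_ideal wdeg weighted_closure \<subseteq> gen_ideal"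
  proof
    fix f assume f: "f \<in> vanishing_ideal wdeg weighted_closure"
    show "f \<in> gen_ideal"
    proof (rule cone_vanish_imp_gen_ideal)
      fix v assume "v \<in> SE3_cone" "alpha_vec v PH \<noteq> 0"
      then have "wpoint wdeg v \<in> weighted_closure"
        by (auto simp: weighted_closure_def dest: alpha_vec_PH_imp_nonzero)
      then show "peval v f = 0"
        using f wpoint_refl by (metis vanishing_idealD)
    qed
  qed
  show "gen_ideal \<subseteq> vanishing_ideal wdeg weighted_closure"
  proof
    fix f assume "f \<in> gen_ideal"
    then show "f \<in> vanishing_ideal wdeg weighted_closure"
      unfolding gen_ideal_def
    proof (rule ideal_generated_subsetI[OF _ vanishing_ideal_subspace], intro subsetI)
      fix g assume g: "g \<in> set generators"
      then obtain n where "homogeneous wdeg n g"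
        using homogeneous_generators by blast
      then show "g \<in> vanishing_ideal wdeg weighted_closure"
      proof (rule vanishing_idealI)
        fix p v assume "p \<in> weighted_closure" "v \<in> p"
        then have "v \<in> SE3_cone"
          by (auto elim!: weighted_closureE simp: cone_wpoint)
        with g show "peval v g = 0" by (simp add: SE3_cone_def)
      qed
    qed
  qed
qed

text \<open>A form vanishing on the isometries pulls back to a polynomial vanishing on the cone
  where h is nonzero. Conversely, an element of the preimage need not be homogeneous, so it is split
  into components, each of which vanishes on the isometries.\<close>

lemma psubst_alpha_vimage_gen_ideal: "psubst alpha_poly -` gen_ideal = SE3_ideal"
proof
  show "SE3_ideal \<subseteq> psubst alpha_poly -` gen_ideal"
  proof
    fix f assume "f \<in> SE3_ideal"
    then show "f \<in> psubst alpha_poly -` gen_ideal"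
      unfolding SE3_ideal_def vanishing_ideal_def
    proof (rule ideal_generated_subsetI[OF _ psubst_ideal_subspace[OF gen_ideal_subspace]], intro subsetI)
      fix g assume "g \<in> {f. (\<exists>n. homogeneous pdeg n f) \<and> (\<forall>p\<in>phi ` SE3. \<forall>v\<in>p. peval v f = 0)}"
      then have g: "\<forall>h\<in>SE3. \<forall>w\<in>phi h. peval w g = 0" by blast
      have "psubst alpha_poly g \<in> gen_ideal"
      proof (rule cone_vanish_imp_gen_ideal)
        fix v assume "v \<in> SE3_cone" "alpha_vec v PH \<noteq> 0"
        then obtain h where "h \<in> SE3" "wpoint pdeg (alpha_vec v) = phi h"
          using cone_to_SE3 by blast
        then show "peval v (psubst alpha_poly g) = 0"
          using g wpoint_refl unfolding peval_psubst_alpha by metis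
      qed
      then show "g \<in> psubst alpha_poly -` gen_ideal" by simp
    qed
  qed
  show "psubst alpha_poly -` gen_ideal \<subseteq> SE3_ideal"
  proof
    fix f assume "f \<in> psubst alpha_poly -` gen_ideal"
    then have f: "peval (alpha_vec v) f = 0" if "v \<in> SE3_cone" for v
      using cone_gen_ideal[OF that] by (simp flip: peval_psubst_alpha)
    have "hom_component pdeg n f \<in> SE3_ideal" for n
      unfolding SE3_ideal_def
    proof (rule vanishing_idealI[OF homogeneous_hom_component])
      fix p w assume "p \<in> phi ` SE3" "w \<in> p"
      then obtain v where v: "v \<in> SE3_cone" "w \<in> wpoint pdeg (alpha_vec v)"
        by (metis image_iff phi_cone)
      have "peval (\<lambda>i. t ^ pdeg i * alpha_vec v i) f = 0" if "t > 0" for t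
      proof -
        \<comment> \<open>Weighted scaling by \<open>sqrt t\<close> keeps the vector in the cone and
          scales its image by \<open>t\<close>; this is why only positive \<open>t\<close> are
          used.\<close>
        let ?v = "\<lambda>i. sqrt t ^ wdeg i * v i"
        have scale: "alpha_vec ?v = (\<lambda>c. t ^ pdeg c * alpha_vec v c)"
        proof
          show "alpha_vec ?v c = t ^ pdeg c * alpha_vec v c" for c
            using homogeneous_eval_wscale[OF homogeneous_alpha_poly, of "\<lambda>a. a" "sqrt t" v c] that
            by (simp add: alpha_vec_def)
        qed
        have "?v \<in> SE3_cone"
          using v(1) cone_wpoint[OF wpoint_real_scale[of "sqrt t" wdeg v]] that by simp
        from f[OF this] show ?thesis unfolding scale .
      qed
      then have "peval (alpha_vec v) (hom_component pdeg n f) = 0"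
        by (rule hom_component_vanish)
      with v(2) show "peval w (hom_component pdeg n f) = 0"
        using homogeneous_wpoint_zero_iff homogeneous_hom_component by blast
    qed
    then have "(\<Sum>n\<in>wtdeg pdeg ` Poly_Mapping.keys f. hom_component pdeg n f) \<in> SE3_ideal"
      unfolding SE3_ideal_def by (intro ideal.subspace_sum vanishing_ideal_subspace) auto
    then show "f \<in> SE3_ideal" by (subst sum_hom_component[of f pdeg])
  qed
qed

section \<open>The closure as the image of \<open>alpha\<close>\<close>

lemma quadrics_SE3_ideal: "quadrics \<subseteq> SE3_ideal"
proof
  fix q assume q: "q \<in> quadrics"
  show "q \<in> SE3_ideal"
    unfolding SE3_ideal_def
  proof (rule vanishing_idealI[OF homogeneous_quadrics[OF q]])
    fix p w assume "p \<in> phi ` SE3" "w \<in> p"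
    then obtain A y where "rotation_matrix A" "w \<in> wpoint pdeg (phi_coords A y)"
      by (auto simp: SE3_def phi_affine)
    then show "peval w q = 0"
      using q phi_coords_quadrics homogeneous_wpoint_zero_iff[OF homogeneous_quadrics[OF q]] by blast
  qed
qed

lemma alpha_vec_0: "alpha_vec (\<lambda>_. 0) = (\<lambda>_. 0)"
proof
  show "alpha_vec (\<lambda>_. 0) c = 0" for c
    using homogeneous_eval_wscale[OF homogeneous_alpha_poly, of "\<lambda>a. a" 0 "\<lambda>_. 0" c]
    by (simp add: alpha_vec_def)
qed

text \<open>Points of the closure satisfy the quadrics and hence lift to the cone up to sign.
  Conversely, forms in \<open>SE3_ideal\<close> pull back into \<open>gen_ideal\<close>, which
  vanishes on the cone.\<close>

lemma SE3_closure_eq: "SE3_closure = alpha ` weighted_closure"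
proof
  show "alpha ` weighted_closure \<subseteq> SE3_closure"
  proof
    fix p assume "p \<in> alpha ` weighted_closure"
    then obtain v where v: "v \<in> SE3_cone" "v \<noteq> (\<lambda>_. 0)" "p = wpoint pdeg (alpha_vec v)"
      by (auto simp: alpha_wpoint elim: weighted_closureE)
    have "peval w f = 0" if "f \<in> SE3_ideal" "w \<in> p" for f w
      using that(1) unfolding SE3_ideal_def vanishing_ideal_def
    proof (rule peval_ideal_generated)
      fix g assume g: "g \<in> {f. (\<exists>n. homogeneous pdeg n f) \<and> (\<forall>p\<in>phi ` SE3. \<forall>v\<in>p. peval v f = 0)}"
      then have "g \<in> SE3_ideal"
        unfolding SE3_ideal_def vanishing_ideal_def by (rule ideal.span_base)
      then have "psubst alpha_poly g \<in> gen_ideal"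
        using psubst_alpha_vimage_gen_ideal by blast
      then have "peval (alpha_vec v) g = 0"
        using cone_gen_ideal[OF v(1)] by (simp flip: peval_psubst_alpha)
      with g that(2) v(3) show "peval w g = 0"
        using homogeneous_wpoint_zero_iff by blast
    qed
    moreover have "p \<in> wproj pdeg"
      unfolding v(3) by (rule wpoint_in_wproj[OF alpha_vec_nonzero[OF v(2)]])
    ultimately show "p \<in> SE3_closure"
      by (auto simp: SE3_closure_def zero_locus_def)
  qed
  show "SE3_closure \<subseteq> alpha ` weighted_closure"
  proof
    fix p assume p: "p \<in> SE3_closure"
    then obtain w where w: "p = wpoint pdeg w" "w \<noteq> (\<lambda>_. 0)"
      by (auto simp: SE3_closure_def zero_locus_def wproj_def)
    have "\<forall>q\<in>quadrics. peval w q = 0"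
      using p quadrics_SE3_ideal wpoint_refl[of w pdeg] by (auto simp: SE3_closure_def zero_locus_def w(1))
    then obtain v l where v: "v \<in> SE3_cone" "l = 1 \<or> l = -1" "w = (\<lambda>c. l * alpha_vec v c)"
      using quadrics_imp_cone by blast
    have "v \<noteq> (\<lambda>_. 0)"
      using v(3) w(2) alpha_vec_0 by auto
    moreover have "w \<in> wpoint pdeg (alpha_vec v)"
      using wpoint_real_scale[of l pdeg "alpha_vec v"] v(2) by (auto simp: v(3))
    then have "p = alpha (wpoint wdeg v)"
      unfolding w(1) alpha_wpoint by (rule wpoint_eq)
    ultimately show "p \<in> alpha ` weighted_closure"
      using v(1) by (auto simp: weighted_closure_def)
  qed
qed

lemma inj_on_alpha: "inj_on alpha weighted_closure"
proof (rule inj_onI)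
  fix q q' assume *: "q \<in> weighted_closure" "q' \<in> weighted_closure" "alpha q = alpha q'"
  then obtain v v' where "q = wpoint wdeg v" "q' = wpoint wdeg v'"
    by (auto elim!: weighted_closureE)
  with *(3) show "q = q'"
    using alpha_vec_inj by (simp add: alpha_wpoint wpoint_eq_iff)
qed

subsection \<open>Regularity\<close>

lemma alpha_vec_in_alpha: "v \<in> q \<Longrightarrow> alpha_vec v \<in> alpha q"
  using wpoint_refl by (force simp: alpha_def simp flip: alpha_vec_def)

lemma regular_on_cong: "(\<And>p. p \<in> U \<Longrightarrow> s p = t p) \<Longrightarrow> regular_on d U s \<longleftrightarrow> regular_on d U t"
  unfolding regular_on_def by (intro ball_cong ex_cong1 conj_cong refl) simp

text \<open>Used for an \<open>inv_into\<close> that is known to agree with \<open>alpha\<close>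
  only on \<open>weighted_closure\<close>.\<close>

lemma regular_map_cong:
  assumes "\<And>p. p \<in> X \<Longrightarrow> h p = k p"
  shows "regular_map d X d' Y h \<longleftrightarrow> regular_map d X d' Y k"
proof -
  have "h ` X = k ` X" using assms by auto
  moreover have "{p \<in> X. h p \<in> V} = {p \<in> X. k p \<in> V}" for V using assms by auto
  moreover have "regular_on d {p \<in> X. k p \<in> V} (s \<circ> h) \<longleftrightarrow> regular_on d {p \<in> X. k p \<in> V} (s \<circ> k)" for V s
    by (rule regular_on_cong) (simp add: assms)
  ultimately show ?thesis by (simp add: regular_map_def)
qed

text \<open>Pulling back doubles the degree of every form, so closed sets pull back to closed sets
  and quotients of forms of equal degree to such quotients.\<close>

lemma regular_map_alpha: "regular_map wdeg weighted_closure pdeg (alpha ` weighted_closure) alpha"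
  unfolding regular_map_def
proof (intro conjI allI impI)
  fix V assume "zariski_open_in pdeg (alpha ` weighted_closure) V"
  then obtain F where F: "\<forall>f\<in>F. \<exists>n. homogeneous pdeg n f" "V = alpha ` weighted_closure - zero_locus pdeg F"
    by (auto simp: zariski_open_in_def zariski_closed_def)
  have F': "\<forall>f\<in>psubst alpha_poly ` F. \<exists>n. homogeneous wdeg n f"
    using F(1) homogeneous_psubst_alpha by blast
  have "alpha q \<in> zero_locus pdeg F \<longleftrightarrow> q \<in> zero_locus wdeg (psubst alpha_poly ` F)"
    if q: "q \<in> weighted_closure" for q
  proof -
    obtain v where v: "q = wpoint wdeg v" "v \<noteq> (\<lambda>_. 0)"
      using q by (blast elim: weighted_closureE)
    show ?thesis
      unfolding v(1) alpha_wpoint wpoint_in_zero_locus_iff[OF F(1) alpha_vec_nonzero[OF v(2)]]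
        wpoint_in_zero_locus_iff[OF F' v(2)]
      by (simp add: peval_psubst_alpha)
  qed
  then have "{q \<in> weighted_closure. alpha q \<in> V} = weighted_closure - zero_locus wdeg (psubst alpha_poly ` F)"
    unfolding F(2) by auto
  with F' show "zariski_open_in wdeg weighted_closure {q \<in> weighted_closure. alpha q \<in> V}"
    unfolding zariski_open_in_def zariski_closed_def by blast
  fix s assume s: "regular_on pdeg V s"
  show "regular_on wdeg {q \<in> weighted_closure. alpha q \<in> V} (s \<circ> alpha)"
    unfolding regular_on_def
  proof
    fix q assume "q \<in> {q \<in> weighted_closure. alpha q \<in> V}"
    then obtain n f g where fg: "homogeneous pdeg n f" "homogeneous pdeg n g"
      "\<forall>w\<in>alpha q. peval w g \<noteq> 0" "\<forall>p\<in>V. \<forall>w\<in>p. peval w g \<noteq> 0 \<longrightarrow> s p = peval w f / peval w g"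
      using s unfolding regular_on_def by blast
    show "\<exists>n f g. homogeneous wdeg n f \<and> homogeneous wdeg n g \<and> (\<forall>v\<in>q. peval v g \<noteq> 0) \<and>
        (\<forall>q\<in>{q \<in> weighted_closure. alpha q \<in> V}. \<forall>v\<in>q. peval v g \<noteq> 0 \<longrightarrow>
          (s \<circ> alpha) q = peval v f / peval v g)"
    proof (intro exI conjI)
      show "homogeneous wdeg (2 * n) (psubst alpha_poly f)" "homogeneous wdeg (2 * n) (psubst alpha_poly g)"
        using fg(1,2) by (simp_all only: homogeneous_psubst_alpha)
    qed (use fg(3,4) alpha_vec_in_alpha in \<open>auto simp: peval_psubst_alpha\<close>)
  qed
qed simp

lemma regular_map_inv_alpha:
  assumes \<beta>: "\<And>q. q \<in> weighted_closure \<Longrightarrow> \<beta> (alpha q) = q"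
  shows "regular_map pdeg (alpha ` weighted_closure) wdeg weighted_closure \<beta>"
  unfolding regular_map_def
proof (intro conjI allI impI)
  show "\<beta> ` alpha ` weighted_closure \<subseteq> weighted_closure"
    using \<beta> by auto
  fix V assume "zariski_open_in wdeg weighted_closure V"
  then obtain F where F: "\<forall>f\<in>F. \<exists>n. homogeneous wdeg n f" "V = weighted_closure - zero_locus wdeg F"
    by (auto simp: zariski_open_in_def zariski_closed_def)
  \<comment> \<open>Squares have even degree, so they lift, and they have the same zeros as the
    forms themselves.\<close>
  define G where "G = {g. \<exists>f\<in>F. \<exists>n. homogeneous pdeg n g \<and> psubst alpha_poly g = f * f}"
  have G: "\<forall>g\<in>G. \<exists>n. homogeneous pdeg n g" by (auto simp: G_def)
  have "alpha q \<in> zero_locus pdeg G \<longleftrightarrow> q \<in> zero_locus wdeg F"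
    if q: "q \<in> weighted_closure" for q
  proof -
    obtain v where v: "q = wpoint wdeg v" "v \<noteq> (\<lambda>_. 0)"
      using q by (blast elim: weighted_closureE)
    have "(\<forall>g\<in>G. peval (alpha_vec v) g = 0) \<longleftrightarrow> (\<forall>f\<in>F. peval v f = 0)"
    proof (intro iffI ballI)
      fix f assume f: "f \<in> F" and 0: "\<forall>g\<in>G. peval (alpha_vec v) g = 0"
      obtain n where n: "homogeneous wdeg n f" using F(1) f by blast
      have "homogeneous wdeg (2 * n) (f * f)"
        by (rule homogeneous_mult[OF n n]) simp
      then obtain g where g: "homogeneous pdeg n g" "psubst alpha_poly g = f * f"
        using lift_even by blast
      with f have "g \<in> G" by (auto simp: G_def)
      with 0 have "peval v (f * f) = 0"
        using g(2) by (metis peval_psubst_alpha)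
      then show "peval v f = 0" by (simp add: peval.mpoly_hom_mult)
    next
      fix g assume "g \<in> G" and 0: "\<forall>f\<in>F. peval v f = 0"
      then obtain f where "f \<in> F" "psubst alpha_poly g = f * f" by (auto simp: G_def)
      with 0 show "peval (alpha_vec v) g = 0"
        by (simp add: peval.mpoly_hom_mult flip: peval_psubst_alpha)
    qed
    then show ?thesis
      unfolding v(1) alpha_wpoint wpoint_in_zero_locus_iff[OF G alpha_vec_nonzero[OF v(2)]]
        wpoint_in_zero_locus_iff[OF F(1) v(2)] .
  qed
  then have "{p \<in> alpha ` weighted_closure. \<beta> p \<in> V} = alpha ` weighted_closure - zero_locus pdeg G"
    unfolding F(2) by (auto simp: \<beta>)
  with G show "zariski_open_in pdeg (alpha ` weighted_closure) {p \<in> alpha ` weighted_closure. \<beta> p \<in> V}"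
    unfolding zariski_open_in_def zariski_closed_def by blast
  fix s assume s: "regular_on wdeg V s"
  show "regular_on pdeg {p \<in> alpha ` weighted_closure. \<beta> p \<in> V} (s \<circ> \<beta>)"
    unfolding regular_on_def
  proof
    fix p assume "p \<in> {p \<in> alpha ` weighted_closure. \<beta> p \<in> V}"
    then obtain q where q: "q \<in> weighted_closure" "p = alpha q" "q \<in> V" by (auto simp: \<beta>)
    then obtain n f g where fg: "homogeneous wdeg n f" "homogeneous wdeg n g"
      "\<forall>v\<in>q. peval v g \<noteq> 0" "\<forall>q\<in>V. \<forall>v\<in>q. peval v g \<noteq> 0 \<longrightarrow> s q = peval v f / peval v g"
      using s unfolding regular_on_def by blast
    \<comment> \<open>Multiplying numerator and denominator by \<open>g\<close> makes the common
      degree even.\<close>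
    have "homogeneous wdeg (2 * n) (f * g)" "homogeneous wdeg (2 * n) (g * g)"
      using fg(1,2) by (auto intro: homogeneous_mult)
    then obtain f' g' where f': "homogeneous pdeg n f'" "psubst alpha_poly f' = f * g"
      and g': "homogeneous pdeg n g'" "psubst alpha_poly g' = g * g"
      using lift_even by metis
    have ev: "peval (alpha_vec v) f' = peval v f * peval v g" "peval (alpha_vec v) g' = peval v g * peval v g"
      for v
      by (simp_all add: f'(2) g'(2) peval.mpoly_hom_mult flip: peval_psubst_alpha)
    show "\<exists>n f g. homogeneous pdeg n f \<and> homogeneous pdeg n g \<and> (\<forall>w\<in>p. peval w g \<noteq> 0) \<and>
        (\<forall>p\<in>{p \<in> alpha ` weighted_closure. \<beta> p \<in> V}. \<forall>w\<in>p. peval w g \<noteq> 0 \<longrightarrow>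
          (s \<circ> \<beta>) p = peval w f / peval w g)"
    proof (intro exI conjI ballI impI)
      show "homogeneous pdeg n f'" "homogeneous pdeg n g'" by fact+
      show "peval w g' \<noteq> 0" if "w \<in> p" for w
      proof -
        obtain v where v: "q = wpoint wdeg v" using q(1) by (blast elim: weighted_closureE)
        then have "peval v g \<noteq> 0" using fg(3) wpoint_refl by metis
        then have "peval (alpha_vec v) g' \<noteq> 0" by (simp add: ev)
        then show ?thesis
          using that homogeneous_wpoint_zero_iff[OF g'(1)] by (simp add: q(2) v alpha_wpoint)
      qed
      fix p w assume "p \<in> {p \<in> alpha ` weighted_closure. \<beta> p \<in> V}" and w: "w \<in> p" "peval w g' \<noteq> 0"
      then obtain q where q: "q \<in> weighted_closure" "p = alpha q" "q \<in> V"
        by (auto simp: \<beta>)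
      then obtain v where "q = wpoint wdeg v"
        by (blast elim: weighted_closureE)
      with q have v: "p = alpha (wpoint wdeg v)" "wpoint wdeg v \<in> V" "\<beta> p = wpoint wdeg v"
        by (simp_all add: \<beta>)
      have w': "w \<in> wpoint pdeg (alpha_vec v)" using w(1) by (simp add: v(1) alpha_wpoint)
      have "peval v g \<noteq> 0"
        using w(2) homogeneous_wpoint_zero_iff[OF g'(1) w'] by (simp add: ev)
      then have "s (wpoint wdeg v) = peval (alpha_vec v) f' / peval (alpha_vec v) g'"
        using fg(4) v(2) wpoint_refl[of v wdeg] by (simp add: ev)
      also have "\<dots> = peval w f' / peval w g'"
        by (rule homogeneous_wpoint_ratio[OF f'(1) g'(1) w', symmetric])
      finally show "(s \<circ> \<beta>) p = peval w f' / peval w g'" by (simp add: v(3))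
    qed
  qed
qed

subsection \<open>Minimality\<close>

text \<open>A generator that is nonzero at a common zero of the others is not in the ideal they
  generate.\<close>

lemma separating_points:
  assumes "i < 6"
  shows "\<exists>v. \<forall>j<6. peval v (generators ! j) = 0 \<longleftrightarrow> j \<noteq> i"
proof -
  define pt :: "(4 \<Rightarrow> real) \<Rightarrow> (3 \<Rightarrow> real) \<Rightarrow> (3 \<Rightarrow> real) \<Rightarrow> real \<Rightarrow> wvar \<Rightarrow> real" where
    "pt e x y r c = (case c of WE i \<Rightarrow> e i | WX i \<Rightarrow> x i | WY i \<Rightarrow> y i | WR \<Rightarrow> r)" for e x y r c
  have all: "(\<forall>j<6. P j) \<longleftrightarrow> P 0 \<and> P 1 \<and> P 2 \<and> P 3 \<and> P 4 \<and> P 5" for P :: "nat \<Rightarrow> bool"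
  proof -
    have "j < 6 \<longleftrightarrow> j = 0 \<or> j = 1 \<or> j = 2 \<or> j = 3 \<or> j = 4 \<or> j = 5" for j :: nat
      by presburger
    then show ?thesis by metis
  qed
  \<comment> \<open>In the first four points x = y, so u = 0 and only e.v or one component of e0 v
    survives, while \<open>r = 1\<close> keeps the quartic zero. In the last two e = 0 kills the
    cubics, and y = 0 or y = x separates the remaining two generators.\<close>
  define v :: "nat \<Rightarrow> wvar \<Rightarrow> real" where "v = (!)
    [pt (\<lambda>k. if k = 1 then 1 else 0) (\<lambda>k. if k = 1 then 1 else 0) (\<lambda>k. if k = 1 then 1 else 0) 1,
     pt (\<lambda>k. if k = 0 then 1 else 0) (\<lambda>k. if k = 1 then 1 else 0) (\<lambda>k. if k = 1 then 1 else 0) 1,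
     pt (\<lambda>k. if k = 0 then 1 else 0) (\<lambda>k. if k = 2 then 1 else 0) (\<lambda>k. if k = 2 then 1 else 0) 1,
     pt (\<lambda>k. if k = 0 then 1 else 0) (\<lambda>k. if k = 3 then 1 else 0) (\<lambda>k. if k = 3 then 1 else 0) 1,
     pt (\<lambda>k. 0) (\<lambda>k. if k = 1 then 1 else 0) (\<lambda>k. 0) 0,
     pt (\<lambda>k. 0) (\<lambda>k. if k = 1 then 1 else 0) (\<lambda>k. if k = 1 then 1 else 0) 0]"
  have "\<forall>i<6. \<forall>j<6. peval (v i) (generators ! j) = 0 \<longleftrightarrow> j \<noteq> i"
    unfolding all generators_explicit quartic_def v_def
    by (simp add: peval.mpoly_hom_simps pt_def)
  with assms show ?thesis by blast
qed

lemma minimally_generated_gen_ideal: "minimally_generated_by gen_ideal generators"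
  unfolding minimally_generated_by_def
proof (intro conjI allI impI notI)
  show "gen_ideal = ideal_generated (set generators)" by (simp add: gen_ideal_def)
  fix i assume "i < length generators"
    and *: "generators ! i \<in> ideal_generated {generators ! j | j. j < length generators \<and> j \<noteq> i}"
  then have "i < 6" and len: "length generators = 6" by (simp_all add: generators_def)
  then obtain v where v: "\<forall>j<6. peval v (generators ! j) = 0 \<longleftrightarrow> j \<noteq> i"
    using separating_points by blast
  from * have "peval v (generators ! i) = 0"
    by (rule peval_ideal_generated) (use v in \<open>auto simp: len\<close>)
  with v \<open>i < 6\<close> show False by blast
qed

lemma phi_id: "phi id = alpha (wpoint wdeg (\<lambda>c. if c = WE 0 then 1 else 0))"
proof -
  have "phi id = phi (\<lambda>v. mat 1 *v v + 0)"
    by (simp add: id_def)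
  also have "\<dots> = wpoint pdeg (phi_coords (mat 1) 0)"
    by (rule phi_affine)
  also have "phi_coords (mat 1) 0 = alpha_vec (\<lambda>c. if c = WE 0 then 1 else 0)"
  proof
    fix c
    have "\<forall>i j. phi_coords (mat 1) 0 (PA i j) = alpha_vec (\<lambda>c. if c = WE 0 then 1 else 0) (PA i j)"
      unfolding forall_3 by (simp add: phi_coords_simps alpha_vec_simps mat_def)
    then show "phi_coords (mat 1) 0 c = alpha_vec (\<lambda>c. if c = WE 0 then 1 else 0) c"
      by (cases c) (simp_all add: phi_coords_simps alpha_vec_simps)
  qed
  finally show ?thesis unfolding alpha_wpoint .
qed

theorem proposition2p8:
  shows "\<exists>\<beta> :: (pvar \<Rightarrow> real) set \<Rightarrow> (wvar \<Rightarrow> real) set.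
    closed_embedding pdeg SE3_closure wdeg \<beta> \<and>
    (\<forall>p\<in>SE3_closure. alpha (\<beta> p) = p) \<and>
    psubst alpha_poly -` vanishing_ideal wdeg (\<beta> ` SE3_closure) = SE3_ideal \<and>
    minimally_generated_by (vanishing_ideal wdeg (\<beta> ` SE3_closure)) generators \<and>
    \<beta> (phi id) = wpoint wdeg (\<lambda>c. if c = WE 0 then 1 else 0)"
proof -
  \<comment> \<open>On \<open>weighted_closure\<close> the map \<open>alpha\<close> is injective
    with image \<open>SE3_closure\<close>; its inverse is the embedding.\<close>
  define \<beta> where "\<beta> = inv_into weighted_closure alpha"
  have \<beta>: "\<beta> (alpha q) = q" if "q \<in> weighted_closure" for q
    using that inj_on_alpha by (simp add: \<beta>_def)
  have image: "\<beta> ` SE3_closure = weighted_closure"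
    using \<beta> by (force simp: SE3_closure_eq)
  have inj: "inj_on \<beta> SE3_closure"
    using \<beta> by (auto simp: SE3_closure_eq inj_on_def)
  have "inv_into SE3_closure \<beta> q = alpha q" if "q \<in> weighted_closure" for q
    using that \<beta> inv_into_f_f[OF inj, of "alpha q"] by (simp add: SE3_closure_eq)
  then have "regular_map wdeg weighted_closure pdeg SE3_closure (inv_into SE3_closure \<beta>)"
    using regular_map_alpha regular_map_cong unfolding SE3_closure_eq by metis
  moreover have "zariski_closed wdeg weighted_closure"
    unfolding zariski_closed_def
    using homogeneous_generators weighted_closure_zero_locus by blast
  moreover have "regular_map pdeg SE3_closure wdeg weighted_closure \<beta>"
    using regular_map_inv_alpha[OF \<beta>] by (simp add: SE3_closure_eq)
  ultimately have "closed_embedding pdeg SE3_closure wdeg \<beta>"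
    using inj by (simp add: closed_embedding_def image)
  moreover have "\<forall>p\<in>SE3_closure. alpha (\<beta> p) = p"
    using \<beta> by (auto simp: SE3_closure_eq)
  \<comment> \<open>Every term of every generator contains one of x, y, r, and these are all 0 at
    this point.\<close>
  moreover have "wpoint wdeg (\<lambda>c. if c = WE 0 then 1 else 0) \<in> weighted_closure"
    unfolding weighted_closure_def by (rule imageI) (auto simp: cone_iff fun_eq_iff)
  then have "\<beta> (phi id) = wpoint wdeg (\<lambda>c. if c = WE 0 then 1 else 0)"
    unfolding phi_id by (rule \<beta>)
  ultimately show ?thesis
    unfolding image vanishing_ideal_weighted_closure
    using psubst_alpha_vimage_gen_ideal minimally_generated_gen_ideal image
      vanishing_ideal_weighted_closure by (intro exI[of _ \<beta>]) simp
qed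

end
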